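(* Let either $a,b\in(-1,\infty)$ with $ab>0$, or $a,b\in\mathbb{C}\setminus\{0\}$ with $b=\overline{a}$. Let $c$ be a positive real number, $\alpha\in\mathbb{D}$, and define for $z\in\mathbb{D}$ $$f_1(z)=z+\overline{\tfrac{\alpha}{2}zF(a,b;c;z)},\quad f_2(z)=z+\overline{\tfrac{\alpha}{2}\bigl(F(a,b;c;z)-1\bigr)},\quad f_3(z)=z+\overline{\tfrac{\alpha}{2}\int_0^zF(a,b;c;t)\,dt}.$$ (a) If $c>\operatorname{Re}(a+b)+2$ and $$|\alpha|\frac{\Gamma(c)\Gamma(c-a-b)}{\Gamma(c-a)\Gamma(c-b)}\left[\frac{2(a)_2(b)_2}{(c-a-b-2)_2}+\frac{5ab}{c-a-b-1}+1\right]\le2,$$ then $f_1\in\mathcal{UK}_H$. (b) If $c>\operatorname{Re}(a+b)+2$ and $$ab|\alpha|\frac{\Gamma(c)\Gamma(c-a-b-1)}{\Gamma(c-a)\Gamma(c-b)}\left(\frac{a+b+c+2ab}{c-a-b-2}\right)\le2,$$ then $f_2\in\mathcal{UK}_H$. (c) If $c>\operatorname{Re}(a+b)+1$ and $$|\alpha|\frac{\Gamma(c)\Gamma(c-a-b)}{\Gamma(c-a)\Gamma(c-b)}\left(\frac{2ab+c-a-b-1}{c-a-b-1}\right)\le2,$$ then $f_3\in\mathcal{UK}_H$.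
   Context: $\mathbb{D}=\{z\in\mathbb{C}:|z|<1\}$. $F(a,b;c;z)=\sum_{n=0}^\infty\frac{(a)_n(b)_n}{(c)_n\,n!}z^n$, $|z|<1$, is the Gaussian hypergeometric function, where $(a)_0=1$ and $(a)_n=a(a+1)\cdots(a+n-1)$ is the Pochhammer symbol. $\mathcal{H}$ is the class of complex-valued harmonic functions $f=h+\overline{g}$ in $\mathbb{D}$, with $h,g$ analytic in $\mathbb{D}$ and $h(z)=z+\sum_{n\ge2}a_nz^n$, $g(z)=\sum_{n\ge1}b_nz^n$. $\mathcal{S}_H$ is the class of $f\in\mathcal{H}$ that are univalent and sense-preserving ($J_f=|h'|^2-|g'|^2>0$) in $\mathbb{D}$. A locally univalent $f\in\mathcal{H}$ is fully convex if $f(\{|z|<r\})$ is a convex domain for each $r\in(0,1)$. It is uniformly convex in $\mathbb{D}$ if it is fully convex in $\mathbb{D}$ and maps every circular arc $\gamma$ contained in $\mathbb{D}$ with center in $\mathbb{D}$ onto a convex arc $f(\gamma)$ (the tangent direction turns monotonically, in the positive sense, as $\gamma$ is traversed positively). It is known that uniform convexity is equivalent to $\operatorname{Re}P(z,\zeta)\ge0$ for all $z\ne\zeta$ in $\mathbb{D}$, where $$P(z,\zeta)=\frac{(z-\zeta)h'(z)+(z-\zeta)^2h''(z)+\overline{(z-\zeta)g'(z)}+\overline{(z-\zeta)^2g''(z)}}{(z-\zeta)h'(z)-\overline{(z-\zeta)g'(z)}}.$$ $\mathcal{UK}_H$ is the class of all $f\in\mathcal{S}_H$ that are uniformly convex in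 $\mathbb{D}$.
   Formalization: In (b) the case a = b = -1 with |α| = 2c is excluded: there the inequality holds with equality, but f_2(z) = z + conj(uz) with |u| = 1 is not univalent (e.g. c = 1/4, α = 1/2), so (b) fails as stated. *)

theory Defs
  imports "HOL-Complex_Analysis.Complex_Analysis"
begin

abbreviation unit_disc :: "complex set"
  where "unit_disc \<equiv> ball 0 1"

definition hypergeom :: "complex \<Rightarrow> complex \<Rightarrow> complex \<Rightarrow> complex \<Rightarrow> complex"
  where "hypergeom a b c z =
    (\<Sum>n. pochhammer a n * pochhammer b n / (pochhammer c n * fact n) * z ^ n)"

definition harmonic_parts ::
    "(complex \<Rightarrow> complex) \<Rightarrow> (complex \<Rightarrow> complex) \<Rightarrow> (complex \<Rightarrow> complex) \<Rightarrow> bool"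
  where "harmonic_parts f h g \<longleftrightarrow>
    h holomorphic_on unit_disc \<and> g holomorphic_on unit_disc \<and>
    (\<exists>a. a 0 = 0 \<and> a 1 = 1 \<and> (\<forall>z\<in>unit_disc. (\<lambda>n. a n * z ^ n) sums h z)) \<and>
    (\<exists>b. b 0 = 0 \<and> (\<forall>z\<in>unit_disc. (\<lambda>n. b n * z ^ n) sums g z)) \<and>
    (\<forall>z\<in>unit_disc. f z = h z + cnj (g z))"

text \<open>
  Membership in the classes below depends only on the values of a function on the unit disc.
\<close>

definition class_H :: "(complex \<Rightarrow> complex) set"
  where "class_H = {f. \<exists>h g. harmonic_parts f h g}"

text \<open>
  The parts of a function in \<open>class_H\<close> are uniquely determined on the unit disc, so the
  existential quantifier below does not leave a choice.
\<close>

definition class_SH :: "(complex \<Rightarrow> complex) set"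
  where "class_SH = {f. inj_on f unit_disc \<and>
    (\<exists>h g. harmonic_parts f h g \<and>
      (\<forall>z\<in>unit_disc. (cmod (deriv h z))\<^sup>2 - (cmod (deriv g z))\<^sup>2 > 0))}"

definition locally_univalent :: "(complex \<Rightarrow> complex) \<Rightarrow> bool"
  where "locally_univalent f \<longleftrightarrow> (\<forall>z\<in>unit_disc. \<exists>e>0. inj_on f (ball z e \<inter> unit_disc))"

definition fully_convex :: "(complex \<Rightarrow> complex) \<Rightarrow> bool"
  where "fully_convex f \<longleftrightarrow> f \<in> class_H \<and> locally_univalent f \<and>
    (\<forall>r. 0 < r \<and> r < 1 \<longrightarrow> open (f ` ball 0 r) \<and> convex (f ` ball 0 r))"

text \<open>
  A parametrised arc is convex if its tangent turns monotonically in the positive sense: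
  \<open>\<theta>\<close> is a continuous nondecreasing choice of the argument of the (nonvanishing) tangent vector.
\<close>

definition convex_arc :: "(real \<Rightarrow> complex) \<Rightarrow> real \<Rightarrow> real \<Rightarrow> bool"
  where "convex_arc w s t \<longleftrightarrow>
    (\<exists>\<theta>. continuous_on {s..t} \<theta> \<and> mono_on {s..t} \<theta> \<and>
      (\<forall>u\<in>{s..t}. \<exists>R>0.
        (w has_vector_derivative complex_of_real R * cis (\<theta> u)) (at u within {s..t})))"

text \<open>
  The circular arcs are \<open>u \<mapsto> \<zeta> + \<rho> cis u\<close> on \<open>{s..t}\<close>, traversed positively. Only the arc and
  its centre, not the whole circle, are required to lie in the unit disc.
\<close>

definition uniformly_convex :: "(complex \<Rightarrow> complex) \<Rightarrow> bool"
  where "uniformly_convex f \<longleftrightarrow> fully_convex f \<and>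
    (\<forall>\<zeta> \<rho> s t. \<zeta> \<in> unit_disc \<and> \<rho> > 0 \<and> s < t \<and> t \<le> s + 2 * pi \<and>
        (\<forall>u\<in>{s..t}. \<zeta> + complex_of_real \<rho> * cis u \<in> unit_disc) \<longrightarrow>
      convex_arc (\<lambda>u. f (\<zeta> + complex_of_real \<rho> * cis u)) s t)"

definition class_UKH :: "(complex \<Rightarrow> complex) set"
  where "class_UKH = {f \<in> class_SH. uniformly_convex f}"

end

theory Submission
  imports Defs
begin

text \<open>
  All three functions have the form \<open>f z = z + cnj (g z)\<close>, where \<open>g z = (\<Sum>n. d n * z ^ (n + 1))\<close> has
  coefficients proportional to hypergeometric ones. The proof has an analytic half, which sums
  these coefficients, and a geometric half, which turns smallness of the sum into uniform
  convexity. They meet in the criterion \<open>power_series_in_class_UKH\<close>: if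
  \<open>(\<Sum>n. (n + 1) * (2 * n + 1) * cmod (d n)) \<le> 1\<close> and \<open>cmod (d 0) < 1\<close>, then \<open>f\<close> belongs to
  \<open>class_UKH\<close>.

  For the geometric half, the coefficient condition gives the pointwise bound
  \<open>cmod (g' z) + 2 * cmod (g'' z) \<le> 1\<close> and a bound \<open>cmod (g' z) \<le> q < 1\<close>. The second makes \<open>g\<close> a
  contraction, so that \<open>f\<close> is an injective perturbation of the identity. The first has two uses.

  Full convexity: parametrise a segment lying in the image of \<open>f\<close> at constant speed and pull it
  back to a curve \<open>Z\<close> in the disc. Differentiating \<open>Z + cnj (g Z) = p + t * d\<close> twice bounds \<open>Z''\<close>
  by \<open>(cmod Z')\<^sup>2\<close>, and so the function \<open>(cmod Z)\<^sup>2\<close> is convex. Hence \<open>cmod Z\<close> is largest at an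
  endpoint, and the segment cannot leave the image of a disc that contains the preimages of its
  endpoints. A connectedness argument then shows that segments between image points of a disc
  centred at 0 do lie in the image.

  Arcs: along \<open>u \<mapsto> \<zeta> + \<rho> * cis u\<close> the tangent of \<open>f\<close> is \<open>\<i> * \<rho> * cis u * (1 - m u)\<close> with
  \<open>cmod (m u) < 1\<close>, so its argument is \<open>pi / 2 + u + Im (Ln (1 - m u))\<close>. The derivative of this is
  the real part of \<open>(1 + m + k) / (1 - m)\<close>, where \<open>cmod k = \<rho> * cmod g''\<close>. Since
  centre and arc lie in the unit disc, \<open>\<rho> \<le> 2\<close>, whence \<open>cmod k \<le> 1 - cmod m\<close>; this makes the
  derivative nonnegative.

  For the analytic half, the hypotheses on \<open>a\<close>, \<open>b\<close>, \<open>c\<close> make every hypergeometric coefficient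
  nonnegative (\<open>hyp_coeff_eq_cmod\<close>). The weighted sums of their moduli are therefore combinations
  of factorial moments of the coefficients at \<open>z = 1\<close>, and shifting the parameters \<open>a\<close>, \<open>b\<close>, \<open>c\<close>
  reduces these to Gauss's theorem \<open>F(a, b; c; 1) = \<Gamma>(c) \<Gamma>(c - a - b) / (\<Gamma>(c - a) \<Gamma>(c - b))\<close>
  (\<open>gauss_summation\<close>). The three inequalities of the theorem are exactly the coefficient condition
  for \<open>d n\<close> equal to \<open>\<alpha> / 2\<close> times \<open>A n\<close>, \<open>A (n + 1)\<close> and \<open>A n / (n + 1)\<close> respectively.
  Given that condition, \<open>cmod (d 0) < 1\<close> fails only in the degenerate case that the second part
  excludes.
\<close>

section \<open>Gauss's summation theorem\<close>

definition hyp_coeff :: "complex \<Rightarrow> complex \<Rightarrow> complex \<Rightarrow> nat \<Rightarrow> complex"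
  where "hyp_coeff a b c n = pochhammer a n * pochhammer b n / (pochhammer c n * fact n)"

lemma hyp_coeff_0 [simp]: "hyp_coeff a b c 0 = 1"
  by (simp add: hyp_coeff_def)

lemma hypergeom_eq_suminf: "hypergeom a b c z = (\<Sum>n. hyp_coeff a b c n * z ^ n)"
  by (simp add: hypergeom_def hyp_coeff_def)

text \<open>
  By the limit formula for the reciprocal Gamma function, \<open>pochhammer z (n + 1)\<close> behaves like
  \<open>rGamma z * n! * n powr z\<close>; in the quotient the factorials cancel. With \<open>d = 1\<close> this is
  the decay rate of the hypergeometric coefficients, and with \<open>a + b = c + d\<close> the infinite product
  that evaluates the series at 1.
\<close>

lemma pochhammer_quotient_asymp:
  fixes a b c d :: complex
  assumes "c \<notin> \<int>\<^sub>\<le>\<^sub>0" and "d \<notin> \<int>\<^sub>\<le>\<^sub>0"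
  shows "(\<lambda>n. pochhammer a (Suc n) * pochhammer b (Suc n) /
             (pochhammer c (Suc n) * pochhammer d (Suc n)) /
             exp ((a + b - c - d) * of_real (ln (of_nat n))))
         \<longlonglongrightarrow> rGamma a * rGamma b * Gamma c * Gamma d"
proof -
  have "(\<lambda>n. rGamma_series a n * rGamma_series b n / (rGamma_series c n * rGamma_series d n))
          \<longlonglongrightarrow> rGamma a * rGamma b / (rGamma c * rGamma d)"
    using assms by (intro tendsto_intros) (auto simp: rGamma_eq_zero_iff)
  moreover have "rGamma_series a n * rGamma_series b n / (rGamma_series c n * rGamma_series d n) =
      pochhammer a (Suc n) * pochhammer b (Suc n) /
        (pochhammer c (Suc n) * pochhammer d (Suc n)) /
        exp ((a + b - c - d) * of_real (ln (of_nat n)))" for n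
    by (simp add: rGamma_series_def field_simps exp_diff exp_add)
  ultimately show ?thesis
    by (simp add: Gamma_def field_simps)
qed

lemma hyp_coeff_Suc_bound:
  assumes "c \<notin> \<int>\<^sub>\<le>\<^sub>0"
  obtains K where "\<And>n. n > 0 \<Longrightarrow>
    norm (hyp_coeff a b c (Suc n)) \<le> K * real n powr (- Re (c - a - b) - 1)"
proof -
  define q where "q = (\<lambda>n. hyp_coeff a b c (Suc n) /
                     exp ((a + b - c - 1) * of_real (ln (of_nat n))))"
  have "q \<longlonglongrightarrow> rGamma a * rGamma b * Gamma c * Gamma 1"
    using pochhammer_quotient_asymp[of c 1 a b] assms
    by (simp add: q_def hyp_coeff_def pochhammer_fact del: pochhammer_Suc)
  then obtain K where K: "\<And>n. norm (q n) \<le> K"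
    using convergent_imp_Bseq[of q] by (auto simp: convergent_def Bseq_def)
  show ?thesis
  proof (rule that[of K])
    fix n :: nat assume n: "n > 0"
    have "norm (exp ((a + b - c - 1) * of_real (ln (of_nat n)))) =
        real n powr (- Re (c - a - b) - 1)"
      using n by (simp add: norm_exp_eq_Re powr_def algebra_simps)
    then have "norm (hyp_coeff a b c (Suc n)) = norm (q n) * real n powr (- Re (c - a - b) - 1)"
      using n by (simp add: q_def norm_divide)
    also have "\<dots> \<le> K * real n powr (- Re (c - a - b) - 1)"
      by (intro mult_right_mono K) auto
    finally show "norm (hyp_coeff a b c (Suc n)) \<le> K * real n powr (- Re (c - a - b) - 1)" .
  qed
qed

lemma summable_norm_hyp_coeff:
  assumes "c \<notin> \<int>\<^sub>\<le>\<^sub>0" and "Re (c - a - b) > 0"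
  shows "summable (\<lambda>n. norm (hyp_coeff a b c n))"
proof -
  obtain K where K: "\<And>n. n > 0 \<Longrightarrow>
      norm (hyp_coeff a b c (Suc n)) \<le> K * real n powr (- Re (c - a - b) - 1)"
    using hyp_coeff_Suc_bound[OF assms(1), of a b] by blast
  have "summable (\<lambda>n. norm (hyp_coeff a b c (Suc n)))"
  proof (rule summable_comparison_test_ev)
    show "eventually (\<lambda>n. norm (norm (hyp_coeff a b c (Suc n))) \<le>
            K * real n powr (- Re (c - a - b) - 1)) sequentially"
      using eventually_gt_at_top[of 0] by eventually_elim (use K in simp)
    show "summable (\<lambda>n. K * real n powr (- Re (c - a - b) - 1))"
      using assms(2) by (intro summable_mult) (simp add: summable_real_powr_iff)
  qed
  then show ?thesis
    by (subst (asm) summable_Suc_iff)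
qed

lemma hyp_coeff_times_index_tendsto_0:
  assumes "c \<notin> \<int>\<^sub>\<le>\<^sub>0" and "Re (c - a - b) > 0"
  shows "(\<lambda>n. of_nat n * hyp_coeff a b c n) \<longlonglongrightarrow> 0"
proof -
  obtain K where K: "\<And>n. n > 0 \<Longrightarrow>
      norm (hyp_coeff a b c (Suc n)) \<le> K * real n powr (- Re (c - a - b) - 1)"
    using hyp_coeff_Suc_bound[OF assms(1), of a b] by blast
  have "(\<lambda>n. of_nat (Suc n) * hyp_coeff a b c (Suc n)) \<longlonglongrightarrow> 0"
  proof (rule Lim_null_comparison)
    show "eventually (\<lambda>n. norm (of_nat (Suc n) * hyp_coeff a b c (Suc n)) \<le>
            2 * K * real n powr (- Re (c - a - b))) sequentially"
      using eventually_gt_at_top[of 0]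
    proof eventually_elim
      case (elim n)
      have "norm (of_nat (Suc n) * hyp_coeff a b c (Suc n)) =
          real (Suc n) * norm (hyp_coeff a b c (Suc n))"
        by (simp only: norm_mult norm_of_nat)
      also have "\<dots> \<le> (2 * real n) * (K * real n powr (- Re (c - a - b) - 1))"
        using elim by (intro mult_mono K) auto
      also have "real n powr (- Re (c - a - b) - 1) = real n powr (- Re (c - a - b)) / real n"
        using elim by (simp add: powr_diff)
      finally show ?case using elim by simp
    qed
    have "((\<lambda>n. real n powr (- Re (c - a - b))) \<longlongrightarrow> 0) sequentially"
      using assms(2) by (intro tendsto_neg_powr filterlim_real_sequentially) simp
    then show "(\<lambda>n. 2 * K * real n powr (- Re (c - a - b))) \<longlonglongrightarrow> 0"
      by (rule tendsto_mult_right_zero)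
  qed
  then show ?thesis
    by (rule LIMSEQ_imp_Suc)
qed

lemma plus_of_nat_not_nonpos_Int:
  fixes c :: complex
  assumes "c \<notin> \<int>\<^sub>\<le>\<^sub>0"
  shows "c + of_nat n \<notin> \<int>\<^sub>\<le>\<^sub>0"
proof
  assume "c + of_nat n \<in> \<int>\<^sub>\<le>\<^sub>0"
  then have "c + of_nat n - of_nat n \<in> \<int>\<^sub>\<le>\<^sub>0" by (rule nonpos_Ints_diff_Nats) simp
  with assms show False by simp
qed

lemma Re_pos_not_nonpos_Int:
  fixes z :: complex
  assumes "Re z > 0"
  shows "z \<notin> \<int>\<^sub>\<le>\<^sub>0"
proof
  assume "z \<in> \<int>\<^sub>\<le>\<^sub>0"
  then obtain n where "z = of_int n" "n \<le> 0" by (auto elim: nonpos_Ints_cases)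
  with assms show False by simp
qed

text \<open>
  Gauss's relation between the series with third parameter \<open>c\<close> and \<open>c + 1\<close>, at the level of
  coefficients: the difference is a discrete derivative, so it disappears on summation.
\<close>

lemma hyp_coeff_contiguous:
  assumes "c \<notin> \<int>\<^sub>\<le>\<^sub>0"
  shows "c * (c - a - b) * hyp_coeff a b c n - (c - a) * (c - b) * hyp_coeff a b (c + 1) n =
         c * (of_nat n * hyp_coeff a b c n - of_nat (Suc n) * hyp_coeff a b c (Suc n))"
proof -
  have nz: "c \<noteq> 0" "c + of_nat n \<noteq> 0" "pochhammer c n \<noteq> 0"
    using assms plus_of_nat_not_nonpos_Int[OF assms, of n]
    by (auto simp: pochhammer_eq_0_iff)
  have "c * pochhammer (c + 1) n = pochhammer c n * (c + of_nat n)"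
    using pochhammer_rec[of c n] pochhammer_Suc[of c n] by simp
  then have "pochhammer (c + 1) n = pochhammer c n * (c + of_nat n) / c"
    using nz by (simp add: field_simps)
  then have 1: "hyp_coeff a b (c + 1) n = hyp_coeff a b c n * c / (c + of_nat n)"
    by (simp add: hyp_coeff_def)
  have 2: "of_nat (Suc n) * hyp_coeff a b c (Suc n) =
      hyp_coeff a b c n * (a + of_nat n) * (b + of_nat n) / (c + of_nat n)"
    using nz by (simp add: hyp_coeff_def pochhammer_Suc divide_simps del: of_nat_Suc) 
  show ?thesis
    unfolding 1 2 using nz by (simp add: field_simps) 
qed

lemma suminf_hyp_coeff_shift:
  assumes "c \<notin> \<int>\<^sub>\<le>\<^sub>0" and "Re (c - a - b) > 0"
  shows "c * (c - a - b) * (\<Sum>n. hyp_coeff a b c n) =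
         (c - a) * (c - b) * (\<Sum>n. hyp_coeff a b (c + 1) n)"
proof -
  have c1: "c + 1 \<notin> \<int>\<^sub>\<le>\<^sub>0"
    using plus_of_nat_not_nonpos_Int[OF assms(1), of 1] by simp
  have s: "(\<lambda>n. hyp_coeff a b c n) sums (\<Sum>n. hyp_coeff a b c n)"
    by (intro summable_sums summable_norm_cancel[OF summable_norm_hyp_coeff] assms)
  have s1: "(\<lambda>n. hyp_coeff a b (c + 1) n) sums (\<Sum>n. hyp_coeff a b (c + 1) n)"
    by (intro summable_sums summable_norm_cancel[OF summable_norm_hyp_coeff] c1)
       (use assms(2) in simp)
  have "(\<lambda>n. c * (of_nat n * hyp_coeff a b c n - of_nat (Suc n) * hyp_coeff a b c (Suc n)))
          sums (c * (of_nat 0 * hyp_coeff a b c 0 - 0))"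
    by (intro sums_mult telescope_sums' hyp_coeff_times_index_tendsto_0 assms)
  moreover have "(\<lambda>n. c * (c - a - b) * hyp_coeff a b c n
                    - (c - a) * (c - b) * hyp_coeff a b (c + 1) n)
      sums (c * (c - a - b) * (\<Sum>n. hyp_coeff a b c n)
            - (c - a) * (c - b) * (\<Sum>n. hyp_coeff a b (c + 1) n))"
    by (intro sums_diff sums_mult s s1)
  ultimately have "c * (c - a - b) * (\<Sum>n. hyp_coeff a b c n)
            - (c - a) * (c - b) * (\<Sum>n. hyp_coeff a b (c + 1) n) = 0"
    unfolding hyp_coeff_contiguous[OF assms(1)] by (simp add: sums_iff)
  then show ?thesis by simp
qed

text \<open>
  For \<open>Re c > 0\<close>, raising \<open>c\<close> to \<open>c + N\<close> enlarges every factor of \<open>pochhammer c n\<close>; keeping the gain from the first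
  factor alone makes the terms with \<open>n > 0\<close> vanish uniformly as \<open>N\<close> grows.
\<close>

lemma norm_hyp_coeff_shift_le:
  assumes "Re c > 0" and "n > 0"
  shows "norm (hyp_coeff a b (c + of_nat N) n) \<le>
         norm c / norm (c + of_nat N) * norm (hyp_coeff a b c n)"
proof -
  obtain m where n: "n = Suc m" using assms(2) gr0_implies_Suc by blast
  have pos: "z + of_nat k \<noteq> 0" if "Re z > 0" for z :: complex and k
    using that by (auto simp: complex_eq_iff)
  have poch: "pochhammer z k \<noteq> 0" if "Re z > 0" for z :: complex and k
    using pos[OF that] by (auto simp: pochhammer_prod)
  have le: "norm (pochhammer (c + 1) m) \<le> norm (pochhammer (c + of_nat N + 1) m)"
    unfolding pochhammer_prod prod_norm[symmetric]
  proof (intro prod_mono conjI norm_ge_zero)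
    fix i
    show "norm (c + 1 + of_nat i) \<le> norm (c + of_nat N + 1 + of_nat i)"
      using assms(1) by (auto simp: cmod_def intro!: power_mono)
  qed
  have p1: "norm (pochhammer c n) = norm c * norm (pochhammer (c + 1) m)"
    and p2: "norm (pochhammer (c + of_nat N) n) =
             norm (c + of_nat N) * norm (pochhammer (c + of_nat N + 1) m)"
    by (simp_all add: n pochhammer_rec norm_mult)
  have nz: "norm c > 0" "norm (c + of_nat N) > 0" "norm (pochhammer (c + 1) m) > 0"
    using pos[of c 0] pos[of c N] poch[of "c + 1" m] assms(1) by auto
  have "norm (hyp_coeff a b (c + of_nat N) n) =
      norm (pochhammer a n * pochhammer b n) / norm (fact n :: complex) / norm (c + of_nat N) /
      norm (pochhammer (c + of_nat N + 1) m)"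
    by (simp add: hyp_coeff_def norm_divide norm_mult p2)
  also have "\<dots> \<le> norm (pochhammer a n * pochhammer b n) / norm (fact n :: complex) /
      norm (c + of_nat N) / norm (pochhammer (c + 1) m)"
    using nz le by (intro divide_left_mono) (auto intro!: mult_pos_pos)
  also have "\<dots> = norm c / norm (c + of_nat N) * norm (hyp_coeff a b c n)"
    using nz by (simp add: hyp_coeff_def norm_divide norm_mult p1)
  finally show ?thesis .
qed

lemma suminf_hyp_coeff_tendsto_1:
  "(\<lambda>N. \<Sum>n. hyp_coeff a b (c + of_nat N) n) \<longlonglongrightarrow> 1"
proof -
  \<comment> \<open>After finitely many shifts the third parameter has positive real part and the series converges.\<close>
  obtain M :: nat where M: "real M > max (- Re c) (Re (a + b - c))"
    using reals_Archimedean2 by blast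
  define c' where "c' = c + of_nat M"
  have c': "Re c' > 0" "Re (c' - a - b) > 0" using M by (auto simp: c'_def)
  have sm: "summable (\<lambda>n. norm (hyp_coeff a b c' (Suc n)))"
    using summable_norm_hyp_coeff[OF Re_pos_not_nonpos_Int c'(2)] c' by (subst summable_Suc_iff) simp
  define B where "B = (\<Sum>n. norm (hyp_coeff a b c' (Suc n)))"
  have "(\<lambda>N. (\<Sum>n. hyp_coeff a b (c' + of_nat N) n) - 1) \<longlonglongrightarrow> 0"
  proof (rule Lim_null_comparison)
    show "eventually (\<lambda>N. norm ((\<Sum>n. hyp_coeff a b (c' + of_nat N) n) - 1) \<le>
        B * norm c' * (1 / norm (c' + of_nat N))) sequentially"
    proof (intro always_eventually allI)
      fix N
      have "summable (\<lambda>n. hyp_coeff a b (c' + of_nat N) n)"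
        by (intro summable_norm_cancel[OF summable_norm_hyp_coeff] Re_pos_not_nonpos_Int) (use c' in auto)
      then have "(\<Sum>n. hyp_coeff a b (c' + of_nat N) n) - 1 =
          (\<Sum>n. hyp_coeff a b (c' + of_nat N) (Suc n))"
        by (subst suminf_split_head) auto
      also have "norm \<dots> \<le> (\<Sum>n. norm c' / norm (c' + of_nat N) * norm (hyp_coeff a b c' (Suc n)))"
        by (intro norm_suminf_le summable_mult sm norm_hyp_coeff_shift_le) (use c' in auto)
      also have "\<dots> = B * norm c' * (1 / norm (c' + of_nat N))"
        unfolding B_def using sm by (subst suminf_mult) auto
      finally show "norm ((\<Sum>n. hyp_coeff a b (c' + of_nat N) n) - 1) \<le>
        B * norm c' * (1 / norm (c' + of_nat N))" .
    qed
    have "filterlim (\<lambda>N. c' + of_nat N) at_infinity sequentially"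
      by (intro tendsto_add_filterlim_at_infinity[OF tendsto_const] tendsto_of_nat)
    then have "filterlim (\<lambda>N. norm (c' + of_nat N)) at_top sequentially"
      by (rule filterlim_at_infinity_imp_norm_at_top)
    then have "(\<lambda>N. 1 / norm (c' + of_nat N)) \<longlonglongrightarrow> 0"
      by (intro tendsto_divide_0[OF tendsto_const] filterlim_at_top_imp_at_infinity)
    then show "(\<lambda>N. B * norm c' * (1 / norm (c' + of_nat N))) \<longlonglongrightarrow> 0"
      by (rule tendsto_mult_right_zero)
  qed
  then have "(\<lambda>N. \<Sum>n. hyp_coeff a b (c' + of_nat N) n) \<longlonglongrightarrow> 1"
    by (simp add: LIM_zero_iff)
  then have "(\<lambda>N. \<Sum>n. hyp_coeff a b (c + of_nat (N + M)) n) \<longlonglongrightarrow> 1"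
    by (simp add: c'_def add_ac)
  then show ?thesis by (rule LIMSEQ_offset)
qed

definition gauss_value :: "complex \<Rightarrow> complex \<Rightarrow> complex \<Rightarrow> complex"
  where "gauss_value a b c = Gamma c * Gamma (c - a - b) / (Gamma (c - a) * Gamma (c - b))"

text \<open>
  Iterating the contiguous relation \<open>N\<close> times expresses the sum as a product \<open>Q N\<close> of Pochhammer
  quotients times the sum with parameter \<open>c + N\<close>. The latter tends to 1 and \<open>Q N\<close> to the Gamma
  quotient.
\<close>

theorem gauss_summation:
  assumes "c \<notin> \<int>\<^sub>\<le>\<^sub>0" and "Re (c - a - b) > 0"
  shows "hyp_coeff a b c sums gauss_value a b c"
proof -
  have d: "c - a - b \<notin> \<int>\<^sub>\<le>\<^sub>0"
    using assms(2) by (rule Re_pos_not_nonpos_Int)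
  define S where "S = (\<lambda>N::nat. \<Sum>n. hyp_coeff a b (c + of_nat N) n)"
  define Q where "Q = (\<lambda>N. pochhammer (c - a) N * pochhammer (c - b) N /
                         (pochhammer c N * pochhammer (c - a - b) N))"
  have step: "S 0 = Q N * S N" for N
  proof (induction N)
    case 0 show ?case by (simp add: Q_def)
  next
    case (Suc N)
    have nz: "c + of_nat N \<noteq> 0" "c - a - b + of_nat N \<noteq> 0"
      using plus_of_nat_not_nonpos_Int[OF assms(1), of N] plus_of_nat_not_nonpos_Int[OF d, of N]
      by (metis zero_in_nonpos_Ints)+
    have "(c + of_nat N) * (c - a - b + of_nat N) * S N =
        (c - a + of_nat N) * (c - b + of_nat N) * S (Suc N)"
      using suminf_hyp_coeff_shift[OF plus_of_nat_not_nonpos_Int[OF assms(1), of N], of a b] assms(2)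
      by (simp add: S_def algebra_simps)
    then have "S N = (c - a + of_nat N) * (c - b + of_nat N) /
        ((c + of_nat N) * (c - a - b + of_nat N)) * S (Suc N)"
      using nz by (simp add: eq_divide_eq mult_ac)
    with Suc show ?case
      by (simp add: Q_def pochhammer_Suc mult_ac)
  qed
  have "(\<lambda>N. Q (Suc N)) \<longlonglongrightarrow> rGamma (c - a) * rGamma (c - b) * Gamma c * Gamma (c - a - b)"
    using pochhammer_quotient_asymp[OF assms(1) d, of "c - a" "c - b"]
    by (simp add: Q_def del: pochhammer_Suc)
  moreover have "(\<lambda>N. S (Suc N)) \<longlonglongrightarrow> 1"
    unfolding S_def using suminf_hyp_coeff_tendsto_1 by (rule LIMSEQ_Suc)
  ultimately have "(\<lambda>N. Q (Suc N) * S (Suc N)) \<longlonglongrightarrow>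
      rGamma (c - a) * rGamma (c - b) * Gamma c * Gamma (c - a - b) * 1"
    by (rule tendsto_mult)
  then have "S 0 = rGamma (c - a) * rGamma (c - b) * Gamma c * Gamma (c - a - b)"
    unfolding step[symmetric] by (simp add: LIMSEQ_const_iff)
  also have "\<dots> = gauss_value a b c"
    by (simp add: gauss_value_def Gamma_def field_simps)
  finally have "(\<Sum>n. hyp_coeff a b c n) = gauss_value a b c" by (simp add: S_def)
  moreover have "summable (hyp_coeff a b c)"
    using summable_norm_cancel[OF summable_norm_hyp_coeff[OF assms]] .
  ultimately show ?thesis by (simp add: sums_iff)
qed

section \<open>Factorial moments of the hypergeometric coefficients\<close>

lemma gauss_value_shift:
  assumes "c \<notin> \<int>\<^sub>\<le>\<^sub>0" and "Re (c - a - b) > 1"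
  shows "gauss_value (a + 1) (b + 1) (c + 1) = c / (c - a - b - 1) * gauss_value a b c"
proof -
  have "c - a - b - 1 \<notin> \<int>\<^sub>\<le>\<^sub>0"
    using assms(2) by (intro Re_pos_not_nonpos_Int) simp
  then have "Gamma (c - a - b) = (c - a - b - 1) * Gamma (c - a - b - 1)"
      "c - a - b - 1 \<noteq> 0"
    using Gamma_plus1[of "c - a - b - 1"] by auto
  moreover have "Gamma (c + 1) = c * Gamma c" using assms(1) by (rule Gamma_plus1)
  moreover have "gauss_value (a + 1) (b + 1) (c + 1) =
      Gamma (c + 1) * Gamma (c - a - b - 1) / (Gamma (c - a) * Gamma (c - b))"
    by (simp add: gauss_value_def algebra_simps)
  ultimately show ?thesis by (simp add: gauss_value_def)
qed

text \<open>
  The coefficient form of \<open>F'(a, b; c; z) = (a * b / c) * F(a + 1, b + 1; c + 1; z)\<close>, by which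
  factorial moments become values of Gauss's theorem at shifted parameters.
\<close>

lemma hyp_coeff_Suc:
  "of_nat (Suc n) * hyp_coeff a b c (Suc n) = a * b / c * hyp_coeff (a + 1) (b + 1) (c + 1) n"
  unfolding hyp_coeff_def pochhammer_rec fact_Suc of_nat_mult
  by (simp add: field_simps del: of_nat_Suc)

lemma hyp_coeff_first_moment:
  assumes "c \<notin> \<int>\<^sub>\<le>\<^sub>0" and "Re (c - a - b) > 1"
  shows "(\<lambda>n. of_nat n * hyp_coeff a b c n) sums (a * b / (c - a - b - 1) * gauss_value a b c)"
proof -
  have c1: "c + 1 \<notin> \<int>\<^sub>\<le>\<^sub>0"
    using plus_of_nat_not_nonpos_Int[OF assms(1), of 1] by simp
  have "c \<noteq> 0" using assms(1) by auto
  have "hyp_coeff (a + 1) (b + 1) (c + 1) sums gauss_value (a + 1) (b + 1) (c + 1)"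
    using assms(2) by (intro gauss_summation c1) simp
  then have "(\<lambda>n. of_nat (Suc n) * hyp_coeff a b c (Suc n)) sums
      (a * b / c * gauss_value (a + 1) (b + 1) (c + 1))"
    unfolding hyp_coeff_Suc by (rule sums_mult)
  also have "a * b / c * gauss_value (a + 1) (b + 1) (c + 1) =
      a * b / (c - a - b - 1) * gauss_value a b c"
    using \<open>c \<noteq> 0\<close> by (simp add: gauss_value_shift[OF assms])
  finally show ?thesis by (subst (asm) sums_Suc_iff) simp
qed

lemma hyp_coeff_second_factorial_moment:
  assumes "c \<notin> \<int>\<^sub>\<le>\<^sub>0" and "Re (c - a - b) > 2"
  shows "(\<lambda>n. of_nat n * (of_nat n - 1) * hyp_coeff a b c n) sums
           (pochhammer a 2 * pochhammer b 2 / pochhammer (c - a - b - 2) 2 * gauss_value a b c)"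
proof -
  have c1: "c + 1 \<notin> \<int>\<^sub>\<le>\<^sub>0"
    using plus_of_nat_not_nonpos_Int[OF assms(1), of 1] by simp
  have "c \<noteq> 0" using assms(1) by auto
  have "(\<lambda>n. of_nat n * hyp_coeff (a + 1) (b + 1) (c + 1) n) sums
      ((a + 1) * (b + 1) / (c + 1 - (a + 1) - (b + 1) - 1) *
        gauss_value (a + 1) (b + 1) (c + 1))"
    using assms(2) by (intro hyp_coeff_first_moment c1) simp
  then have "(\<lambda>n. a * b / c * (of_nat n * hyp_coeff (a + 1) (b + 1) (c + 1) n)) sums
      (a * b / c * ((a + 1) * (b + 1) / (c + 1 - (a + 1) - (b + 1) - 1) *
        gauss_value (a + 1) (b + 1) (c + 1)))"
    by (rule sums_mult)
  also have "(\<lambda>n. a * b / c * (of_nat n * hyp_coeff (a + 1) (b + 1) (c + 1) n)) =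
      (\<lambda>n. of_nat (Suc n) * (of_nat (Suc n) - 1) * hyp_coeff a b c (Suc n))"
    using hyp_coeff_Suc[of _ a b c] by (auto simp: mult_ac)
  also have "a * b / c * ((a + 1) * (b + 1) / (c + 1 - (a + 1) - (b + 1) - 1) *
        gauss_value (a + 1) (b + 1) (c + 1)) =
      pochhammer a 2 * pochhammer b 2 / pochhammer (c - a - b - 2) 2 * gauss_value a b c"
  proof -
    have 1: "c + 1 - (a + 1) - (b + 1) - 1 = c - a - b - 2" by simp
    have "pochhammer (c - a - b - 2) 2 = (c - a - b - 2) * (c - a - b - 1)"
      by (simp add: numeral_2_eq_2 pochhammer_Suc)
    moreover have "gauss_value (a + 1) (b + 1) (c + 1) = c / (c - a - b - 1) * gauss_value a b c"
      using assms by (intro gauss_value_shift) auto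
    ultimately show ?thesis
      unfolding 1 using \<open>c \<noteq> 0\<close>
      by (simp add: pochhammer_Suc[of _ 1, simplified, folded numeral_2_eq_2] mult_ac)
  qed
  finally show ?thesis by (subst (asm) sums_Suc_iff) simp
qed

text \<open>
  Each product \<open>(a + i) * (b + i)\<close> is nonnegative: it is \<open>(cmod (a + i))\<^sup>2\<close> for conjugate parameters;
  for real ones the case \<open>i = 0\<close> is the hypothesis \<open>a * b > 0\<close>, and both factors are positive for
  \<open>i > 0\<close>.
\<close>

lemma hyp_coeff_eq_cmod:
  assumes "(a \<in> \<real> \<and> b \<in> \<real> \<and> Re a > -1 \<and> Re b > -1 \<and> Re (a * b) > 0) \<or> b = cnj a"
    and "c > 0"
  shows "hyp_coeff a b (of_real c) n = of_real (cmod (hyp_coeff a b (of_real c) n))"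
proof -
  have factor: "(a + of_nat i) * (b + of_nat i) \<in> \<real>\<^sub>\<ge>\<^sub>0" for i
    using assms(1)
  proof
    assume "b = cnj a"
    then have "(a + of_nat i) * (b + of_nat i) = of_real ((cmod (a + of_nat i))\<^sup>2)"
      using complex_norm_square[of "a + of_nat i"] by simp
    then show ?thesis by (simp only: nonneg_Reals_of_real_iff) simp
  next
    assume h: "a \<in> \<real> \<and> b \<in> \<real> \<and> Re a > -1 \<and> Re b > -1 \<and> Re (a * b) > 0"
    then obtain x y where xy: "a = of_real x" "b = of_real y" by (auto elim!: Reals_cases)
    have "(x + real i) * (y + real i) \<ge> 0"
      using h xy by (cases "i = 0") auto
    moreover have "(a + of_nat i) * (b + of_nat i) = of_real ((x + real i) * (y + real i))"
      by (simp add: xy)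
    ultimately show ?thesis by (simp only: nonneg_Reals_of_real_iff)
  qed
  have poch: "pochhammer a n * pochhammer b n \<in> \<real>\<^sub>\<ge>\<^sub>0"
  proof (induction n)
    case (Suc n)
    then have "(pochhammer a n * pochhammer b n) * ((a + of_nat n) * (b + of_nat n)) \<in> \<real>\<^sub>\<ge>\<^sub>0"
      using factor by (rule nonneg_Reals_mult_I)
    then show ?case by (simp add: pochhammer_Suc mult_ac)
  qed simp
  have "hyp_coeff a b (of_real c) n =
      pochhammer a n * pochhammer b n * of_real (inverse (pochhammer c n * fact n))"
    by (simp add: hyp_coeff_def pochhammer_of_real divide_inverse)
  moreover have "complex_of_real (inverse (pochhammer c n * fact n)) \<in> \<real>\<^sub>\<ge>\<^sub>0"
    using pochhammer_pos[OF assms(2), of n] by (simp only: nonneg_Reals_of_real_iff) simp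
  ultimately have "hyp_coeff a b (of_real c) n \<in> \<real>\<^sub>\<ge>\<^sub>0"
    by (simp only:) (rule nonneg_Reals_mult_I[OF poch])
  then show ?thesis by (auto elim!: nonneg_Reals_cases)
qed

section \<open>Harmonic perturbations of the identity\<close>

text \<open>
  The factor 2 is the least upper bound for the distance between two points of the unit disc, hence
  for the radius of an arc in the disc whose centre is also in the disc. The uniform bound \<open>q\<close> keeps
  \<open>g\<close> a strict contraction.
\<close>

locale small_antianalytic_part =
  fixes g :: "complex \<Rightarrow> complex" and q :: real
  assumes holo: "g holomorphic_on unit_disc"
    and q_less: "q < 1"
    and deriv_le: "\<And>z. z \<in> unit_disc \<Longrightarrow> cmod (deriv g z) \<le> q"
    and deriv2_le: "\<And>z. z \<in> unit_disc \<Longrightarrow>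
                      cmod (deriv g z) + 2 * cmod (deriv (deriv g) z) \<le> 1"
begin

definition harmonic_map :: "complex \<Rightarrow> complex"
  where "harmonic_map z = z + cnj (g z)"

lemma deriv_less_1: "z \<in> unit_disc \<Longrightarrow> cmod (deriv g z) < 1"
  using deriv_le q_less by fastforce

lemma g_DERIV: "z \<in> unit_disc \<Longrightarrow> (g has_field_derivative deriv g z) (at z)"
  using holo by (intro holomorphic_derivI[where S = unit_disc]) auto

lemma g_DERIV2: "z \<in> unit_disc \<Longrightarrow> (deriv g has_field_derivative deriv (deriv g) z) (at z)"
  using holo by (intro holomorphic_derivI[where S = unit_disc] holomorphic_deriv) auto

lemma harmonic_map_has_derivative:
  assumes "z \<in> unit_disc"
  shows "(harmonic_map has_derivative (\<lambda>v. v + cnj (deriv g z * v))) (at z)"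
proof -
  have "(g has_derivative (\<lambda>v. deriv g z * v)) (at z)"
    using g_DERIV[OF assms] by (simp add: has_field_derivative_def)
  then have "((\<lambda>z. cnj (g z)) has_derivative (\<lambda>v. cnj (deriv g z * v))) (at z)"
    by (rule bounded_linear.has_derivative[OF bounded_linear_cnj])
  then have "((\<lambda>z. z + cnj (g z)) has_derivative (\<lambda>v. v + cnj (deriv g z * v))) (at z)"
    by (intro has_derivative_add has_derivative_ident)
  then show ?thesis by (simp add: harmonic_map_def[abs_def])
qed

lemma continuous_on_harmonic_map: "continuous_on unit_disc harmonic_map"
  by (intro continuous_at_imp_continuous_on ballI)
     (metis harmonic_map_has_derivative has_derivative_continuous)

lemma inj_on_harmonic_map: "inj_on harmonic_map unit_disc"
proof (rule inj_onI)
  fix x y assume xy: "x \<in> unit_disc" "y \<in> unit_disc" and eq: "harmonic_map x = harmonic_map y"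
  have "cmod (g x - g y) \<le> q * cmod (x - y)"
    using xy g_DERIV deriv_le
    by (intro field_differentiable_bound[where S = unit_disc and f' = "deriv g"])
       (auto intro: has_field_derivative_at_within)
  moreover have "x - y = - cnj (g x - g y)"
    using eq by (simp add: harmonic_map_def algebra_simps)
  then have "cmod (x - y) = cmod (g x - g y)"
    by (metis complex_mod_cnj norm_minus_cancel)
  ultimately have "(1 - q) * cmod (x - y) \<le> 0"
    by (simp add: algebra_simps)
  then have "cmod (x - y) \<le> 0"
    using q_less by (simp add: mult_le_0_iff)
  then show "x = y" by simp
qed

lemma open_harmonic_map_image: "r \<le> 1 \<Longrightarrow> open (harmonic_map ` ball 0 r)"
  by (intro invariance_of_domain continuous_on_subset[OF continuous_on_harmonic_map]
        inj_on_subset[OF inj_on_harmonic_map]) auto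

definition harmonic_inv :: "complex \<Rightarrow> complex"
  where "harmonic_inv = inv_into unit_disc harmonic_map"

lemma harmonic_inv_harmonic_map: "z \<in> unit_disc \<Longrightarrow> harmonic_inv (harmonic_map z) = z"
  unfolding harmonic_inv_def by (rule inv_into_f_f[OF inj_on_harmonic_map])

lemma harmonic_inv_mem: "w \<in> harmonic_map ` unit_disc \<Longrightarrow> harmonic_inv w \<in> unit_disc"
  unfolding harmonic_inv_def by (rule inv_into_into)

lemma harmonic_map_harmonic_inv: "w \<in> harmonic_map ` unit_disc \<Longrightarrow> harmonic_map (harmonic_inv w) = w"
  unfolding harmonic_inv_def by (rule f_inv_into_f)

lemma one_minus_deriv_nz:
  assumes "z \<in> unit_disc"
  shows "1 - deriv g z * cnj (deriv g z) \<noteq> 0"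
proof -
  have "(cmod (deriv g z))\<^sup>2 < 1"
    using deriv_less_1[OF assms] by (simp add: abs_square_less_1)
  moreover have "1 - deriv g z * cnj (deriv g z) = of_real (1 - (cmod (deriv g z))\<^sup>2)"
    using complex_norm_square[of "deriv g z"] by simp
  ultimately show ?thesis by (metis diff_gt_0_iff_gt less_irrefl of_real_eq_0_iff)
qed

text \<open>
  The real-linear equation \<open>u + cnj (m * u) = v\<close> is solved by
  \<open>u = (v - cnj m * cnj v) / (1 - m * cnj m)\<close>.
\<close>

lemma harmonic_inv_has_derivative:
  assumes "z \<in> unit_disc"
  shows "(harmonic_inv has_derivative
           (\<lambda>v. (v - cnj (deriv g z) * cnj v) / (1 - deriv g z * cnj (deriv g z)))) (at (harmonic_map z))"
proof (rule has_derivative_inverse_strong[where S = unit_disc and f = harmonic_map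
          and f' = "\<lambda>v. v + cnj (deriv g z * v)"])
  show "(\<lambda>v. v + cnj (deriv g z * v)) \<circ>
      (\<lambda>v. (v - cnj (deriv g z) * cnj v) / (1 - deriv g z * cnj (deriv g z))) = id"
  proof
    fix v
    define m where "m = deriv g z"
    define D where "D = 1 - m * cnj m"
    have D: "D \<noteq> 0" "cnj D = D"
      using one_minus_deriv_nz[OF assms] by (auto simp: D_def m_def)
    have "(v - cnj m * cnj v) / D + cnj (m * ((v - cnj m * cnj v) / D)) =
        (v - cnj m * cnj v + cnj m * (cnj v - m * v)) / D"
      by (simp add: D(2) add_divide_distrib)
    also have "v - cnj m * cnj v + cnj m * (cnj v - m * v) = v * D"
      by (simp add: D_def algebra_simps)
    finally show "((\<lambda>v. v + cnj (deriv g z * v)) \<circ>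
      (\<lambda>v. (v - cnj (deriv g z) * cnj v) / (1 - deriv g z * cnj (deriv g z)))) v = id v"
      using D(1) by (simp add: D_def m_def)
  qed
qed (use assms continuous_on_harmonic_map harmonic_inv_harmonic_map harmonic_map_has_derivative in auto)

text \<open>
  Let \<open>Z t\<close> be the preimage of \<open>p + t * d\<close> and \<open>V = Z'\<close>. Differentiating \<open>V + cnj (g' V) = d\<close> gives
  \<open>V' + cnj (g' V' + g'' V\<^sup>2) = 0\<close>, so \<open>(1 - cmod g') * cmod V' \<le> cmod g'' * (cmod V)\<^sup>2\<close> and thus
  \<open>cmod V' \<le> (cmod V)\<^sup>2\<close>. As \<open>cmod Z < 1\<close>, the second derivative
  \<open>2 * ((cmod V)\<^sup>2 + Re (cnj Z * V'))\<close> of \<open>(cmod Z)\<^sup>2\<close> is nonnegative.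
\<close>

lemma cmod_harmonic_inv_segment_convex:
  assumes seg: "\<And>t. t \<in> {0..1} \<Longrightarrow> p + of_real t * d \<in> harmonic_map ` unit_disc"
  shows "convex_on {0..1} (\<lambda>t. (cmod (harmonic_inv (p + of_real t * d)))\<^sup>2)"
proof -
  \<comment> \<open>Derivatives are taken on an open set of parameters, so that they are two-sided at 0 and 1.\<close>
  define T where "T = {t::real. p + of_real t * d \<in> harmonic_map ` unit_disc}"
  define Z where "Z = (\<lambda>t. harmonic_inv (p + of_real t * d))"
  define V where "V = (\<lambda>t. (d - cnj (deriv g (Z t)) * cnj d) /
                         (1 - deriv g (Z t) * cnj (deriv g (Z t))))"
  have "open ((\<lambda>t::real. p + of_real t * d) -` (harmonic_map ` unit_disc))"
    by (intro open_vimage open_harmonic_map_image continuous_intros) simp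
  then have opT: "open T" by (simp add: T_def vimage_def)
  have ZD: "Z t \<in> unit_disc" if "t \<in> T" for t
    using that harmonic_inv_mem by (auto simp: T_def Z_def)
  have FZ: "harmonic_map (Z t) = p + of_real t * d" if "t \<in> T" for t
    using that harmonic_map_harmonic_inv by (auto simp: T_def Z_def)
  have dZ: "(Z has_vector_derivative V t) (at t)" if t: "t \<in> T" for t
  proof -
    have "((\<lambda>t. p + of_real t * d) has_derivative (\<lambda>h. of_real h * d)) (at t)"
      by (auto intro!: derivative_eq_intros)
    moreover have "(harmonic_inv has_derivative
           (\<lambda>v. (v - cnj (deriv g (Z t)) * cnj v) /
                (1 - deriv g (Z t) * cnj (deriv g (Z t))))) (at (p + of_real t * d))"
      using harmonic_inv_has_derivative[OF ZD[OF t]] FZ[OF t] by simp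
    ultimately have "((\<lambda>t. harmonic_inv (p + of_real t * d)) has_derivative
        (\<lambda>h. (of_real h * d - cnj (deriv g (Z t)) * cnj (of_real h * d)) /
             (1 - deriv g (Z t) * cnj (deriv g (Z t))))) (at t)"
      by (rule has_derivative_compose)
    moreover have "(of_real h * d - cnj (deriv g (Z t)) * cnj (of_real h * d)) /
             (1 - deriv g (Z t) * cnj (deriv g (Z t))) = h *\<^sub>R V t" for h
      by (simp add: V_def scaleR_conv_of_real algebra_simps diff_divide_distrib)
    ultimately show ?thesis
      by (simp add: has_vector_derivative_def Z_def)
  qed
  have dg: "((\<lambda>t. deriv g (Z t)) has_vector_derivative (V t * deriv (deriv g) (Z t))) (at t)"
    if t: "t \<in> T" for t
    using field_vector_diff_chain_at[OF dZ[OF t] g_DERIV2[OF ZD[OF t]]] by (simp add: o_def)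
  have "\<exists>V'. (V has_vector_derivative V') (at t)" if t: "t \<in> T" for t
  proof -
    have d1: "(\<lambda>t. deriv g (Z t)) differentiable (at t)"
      and d2: "(\<lambda>t. cnj (deriv g (Z t))) differentiable (at t)"
      using dg[OF t] has_vector_derivative_cnj[OF dg[OF t]] by (auto intro: differentiableI_vector)
    have "V differentiable (at t)"
      unfolding V_def using one_minus_deriv_nz[OF ZD[OF t]]
      by (intro differentiable_divide differentiable_diff differentiable_mult
           differentiable_const d1 d2) auto
    then show ?thesis by (auto simp: vector_derivative_works)
  qed
  then obtain V' where dV: "\<And>t. t \<in> T \<Longrightarrow> (V has_vector_derivative V' t) (at t)"
    by metis
  have Veq: "V t + cnj (deriv g (Z t) * V t) = d" if t: "t \<in> T" for t
  proof -
    define m where "m = deriv g (Z t)"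
    define D where "D = 1 - m * cnj m"
    have D: "D \<noteq> 0" "cnj D = D"
      using one_minus_deriv_nz[OF ZD[OF t]] by (auto simp: D_def m_def)
    have "V t = (d - cnj m * cnj d) / D" by (simp add: V_def m_def D_def)
    then have "V t + cnj (m * V t) = (d - cnj m * cnj d + cnj m * (cnj d - m * d)) / D"
      by (simp add: D(2) add_divide_distrib)
    also have "d - cnj m * cnj d + cnj m * (cnj d - m * d) = d * D"
      by (simp add: D_def algebra_simps)
    finally show ?thesis using D(1) by (simp add: m_def)
  qed
  have V'eq: "V' t + cnj (deriv g (Z t) * V' t + V t * deriv (deriv g) (Z t) * V t) = 0"
    if t: "t \<in> T" for t
  proof -
    have "((\<lambda>t. V t + cnj (deriv g (Z t) * V t)) has_vector_derivative
        (V' t + cnj (deriv g (Z t) * V' t + V t * deriv (deriv g) (Z t) * V t))) (at t)"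
      by (intro has_vector_derivative_add has_vector_derivative_cnj has_vector_derivative_mult
            dV dg t)
    then have "((\<lambda>t. d) has_vector_derivative
        (V' t + cnj (deriv g (Z t) * V' t + V t * deriv (deriv g) (Z t) * V t))) (at t)"
      by (rule has_vector_derivative_transform_within_open[OF _ opT t]) (rule Veq)
    then show ?thesis
      using vector_derivative_unique_at[OF has_vector_derivative_const] by metis
  qed
  have bound: "cmod (Z t) * cmod (V' t) \<le> (cmod (V t))\<^sup>2" if t: "t \<in> T" for t
  proof -
    define m k where "m = cmod (deriv g (Z t))" and "k = cmod (deriv (deriv g) (Z t))"
    have m: "m < 1" "m + 2 * k \<le> 1" "0 \<le> k"
      using deriv_less_1 deriv2_le ZD[OF t] by (auto simp: m_def k_def)
    have "cmod (V' t) = cmod (deriv g (Z t) * V' t + V t * deriv (deriv g) (Z t) * V t)"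
      using V'eq[OF t] by (metis add_eq_0_iff2 complex_mod_cnj norm_minus_cancel)
    also have "\<dots> \<le> m * cmod (V' t) + k * (cmod (V t))\<^sup>2"
      by (rule order_trans[OF norm_triangle_ineq])
         (simp add: norm_mult m_def k_def power2_eq_square)
    finally have "(1 - m) * cmod (V' t) \<le> k * (cmod (V t))\<^sup>2" by (simp add: algebra_simps)
    also have "\<dots> \<le> (1 - m) * (cmod (V t))\<^sup>2"
      using m by (intro mult_right_mono) auto
    finally have "cmod (V' t) \<le> (cmod (V t))\<^sup>2"
      using m by simp
    moreover have "cmod (Z t) * cmod (V' t) \<le> 1 * cmod (V' t)"
      using ZD[OF t] by (intro mult_right_mono) auto
    ultimately show ?thesis by simp
  qed
  have sub: "{0..1} \<subseteq> T" using seg by (auto simp: T_def)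
  show ?thesis
  proof (rule f''_ge0_imp_convex)
    fix t :: real assume "t \<in> {0..1}"
    then have t: "t \<in> T" using sub by auto
    note derivs = dZ[OF t] dV[OF t]
    have sq: "(cmod (harmonic_inv (p + of_real t * d)))\<^sup>2 = (Re (Z t))\<^sup>2 + (Im (Z t))\<^sup>2" for t
      by (simp add: Z_def cmod_power2)
    show "((\<lambda>t. (cmod (harmonic_inv (p + of_real t * d)))\<^sup>2) has_real_derivative
        2 * (Re (Z t) * Re (V t) + Im (Z t) * Im (V t))) (at t)"
      unfolding sq using derivs by (auto intro!: derivative_eq_intros simp: algebra_simps)
    show "((\<lambda>t. 2 * (Re (Z t) * Re (V t) + Im (Z t) * Im (V t))) has_real_derivative
        2 * ((cmod (V t))\<^sup>2 + Re (cnj (Z t) * V' t))) (at t)"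
      using derivs
      by (auto intro!: derivative_eq_intros
               simp: algebra_simps power2_eq_square cmod_power2[unfolded power2_eq_square])
    have "- (cmod (Z t) * cmod (V' t)) \<le> Re (cnj (Z t) * V' t)"
      using abs_Re_le_cmod[of "cnj (Z t) * V' t"] by (simp add: norm_mult)
    then show "0 \<le> 2 * ((cmod (V t))\<^sup>2 + Re (cnj (Z t) * V' t))"
      using bound[OF t] by simp
  qed simp
qed

lemma segment_subset_harmonic_map_cball:
  assumes z: "z \<in> unit_disc" "w \<in> unit_disc" and r: "cmod z \<le> r" "cmod w \<le> r"
    and seg: "closed_segment (harmonic_map z) (harmonic_map w) \<subseteq> harmonic_map ` unit_disc"
  shows "closed_segment (harmonic_map z) (harmonic_map w) \<subseteq> harmonic_map ` cball 0 r"
proof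
  fix y assume y: "y \<in> closed_segment (harmonic_map z) (harmonic_map w)"
  define Z where "Z = (\<lambda>t::real. harmonic_inv (harmonic_map z + of_real t * (harmonic_map w - harmonic_map z)))"
  have inseg: "harmonic_map z + of_real t * (harmonic_map w - harmonic_map z) \<in> closed_segment (harmonic_map z) (harmonic_map w)"
    if "t \<in> {0..1}" for t
    using that by (auto simp: in_segment scaleR_conv_of_real algebra_simps intro!: exI[of _ t])
  obtain t where t: "t \<in> {0..1}" "y = harmonic_map z + of_real t * (harmonic_map w - harmonic_map z)"
    using y by (auto simp: in_segment scaleR_conv_of_real algebra_simps)
  have "convex_on {0..1} (\<lambda>t. (cmod (Z t))\<^sup>2)"
    unfolding Z_def by (rule cmod_harmonic_inv_segment_convex) (use seg inseg in blast)
  then have "(cmod (Z t))\<^sup>2 \<le> (1 - t) * (cmod (Z 0))\<^sup>2 + t * (cmod (Z 1))\<^sup>2"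
    using convex_onD[of "{0..1}" "\<lambda>t. (cmod (Z t))\<^sup>2" t 0 1] t(1) by simp
  also have "\<dots> = (1 - t) * (cmod z)\<^sup>2 + t * (cmod w)\<^sup>2"
    using z by (simp add: Z_def harmonic_inv_harmonic_map)
  also have "\<dots> \<le> (1 - t) * r\<^sup>2 + t * r\<^sup>2"
    using t(1) r by (intro add_mono mult_left_mono power_mono) auto
  finally have "(cmod (Z t))\<^sup>2 \<le> r\<^sup>2" by (simp add: algebra_simps)
  then have "cmod (Z t) \<le> r"
    using r norm_ge_zero[of z] by (simp add: abs_le_square_iff[symmetric])
  moreover have "harmonic_map (Z t) = y"
    using seg y t(2) harmonic_map_harmonic_inv[of y] by (auto simp: Z_def)
  ultimately show "y \<in> harmonic_map ` cball 0 r" by force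
qed

text \<open>
  Join the image of \<open>z1\<close> by a straight segment to a point that moves along the image of the segment
  from \<open>z1\<close> to \<open>z2\<close>. The set \<open>A\<close> of positions for which the straight segment stays in the image of
  the unit disc is open, because that image is open and the segment compact. It is also closed,
  because such a segment already stays in the compact image of the disc of radius \<open>\<rho> < 1\<close>.
\<close>

lemma convex_harmonic_map_image:
  assumes "r \<le> 1"
  shows "convex (harmonic_map ` ball 0 r)"
  unfolding convex_contains_segment
proof (intro ballI)
  fix y1 y2 assume "y1 \<in> harmonic_map ` ball 0 r" "y2 \<in> harmonic_map ` ball 0 r"
  then obtain z1 z2 where z: "z1 \<in> ball 0 r" "z2 \<in> ball 0 r" "y1 = harmonic_map z1" "y2 = harmonic_map z2" by blast
  define \<rho> where "\<rho> = max (cmod z1) (cmod z2)"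
  have \<rho>: "\<rho> < r" "cball 0 \<rho> \<subseteq> ball (0::complex) r" "cball 0 \<rho> \<subseteq> unit_disc"
    using z assms by (auto simp: \<rho>_def)
  define z where "z = (\<lambda>s::real. z1 + of_real s * (z2 - z1))"
  have zball: "z s \<in> cball 0 \<rho>" if "s \<in> {0..1}" for s
  proof -
    have "z s \<in> closed_segment z1 z2"
      using that by (auto simp: z_def in_segment scaleR_conv_of_real algebra_simps intro!: exI[of _ s])
    also have "closed_segment z1 z2 \<subseteq> cball 0 \<rho>"
      by (intro closed_segment_subset) (auto simp: \<rho>_def)
    finally show ?thesis .
  qed
  define H where "H = (\<lambda>(s, t). harmonic_map z1 + of_real t * (harmonic_map (z s) - harmonic_map z1))"
  have contFz: "continuous_on {0..1} (\<lambda>s. harmonic_map (z s))"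
    by (rule continuous_on_compose2[OF continuous_on_harmonic_map])
       (use zball \<rho> in \<open>auto simp: z_def intro!: continuous_intros\<close>)
  have contH: "continuous_on ({0..1} \<times> {0..1}) H"
    unfolding H_def case_prod_unfold
    by (intro continuous_intros continuous_on_compose2[OF contFz]) auto
  have segH: "closed_segment (harmonic_map z1) (harmonic_map (z s)) = (\<lambda>t. H (s, t)) ` {0..1}" for s
    by (auto simp: H_def in_segment scaleR_conv_of_real algebra_simps image_iff Bex_def)
  define A where "A = {s \<in> {0..1}. \<forall>t\<in>{0..1}. H (s, t) \<in> harmonic_map ` unit_disc}"
  define B where "B = fst ` {x \<in> {0..1} \<times> {0..1}. H x \<in> - (harmonic_map ` unit_disc)}"
  have A_eq: "A = (\<Inter>t\<in>{0..1}. {s \<in> {0..1}. H (s, t) \<in> harmonic_map ` cball 0 \<rho>})"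
  proof (intro equalityI subsetI)
    fix s assume s: "s \<in> A"
    then have "closed_segment (harmonic_map z1) (harmonic_map (z s)) \<subseteq> harmonic_map ` unit_disc"
      unfolding segH A_def by auto
    then have "closed_segment (harmonic_map z1) (harmonic_map (z s)) \<subseteq> harmonic_map ` cball 0 \<rho>"
      using s zball[of s] \<rho> z assms by (intro segment_subset_harmonic_map_cball) (auto simp: A_def \<rho>_def)
    then show "s \<in> (\<Inter>t\<in>{0..1}. {s \<in> {0..1}. H (s, t) \<in> harmonic_map ` cball 0 \<rho>})"
      using s unfolding segH A_def by auto
  next
    fix s assume s: "s \<in> (\<Inter>t\<in>{0..1}. {s \<in> {0..1}. H (s, t) \<in> harmonic_map ` cball 0 \<rho>})"
    then have "s \<in> {0..1}" by force
    then show "s \<in> A" using s \<rho>(3) unfolding A_def by blast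
  qed
  have "compact (harmonic_map ` cball 0 \<rho>)"
    by (intro compact_continuous_image continuous_on_subset[OF continuous_on_harmonic_map] \<rho>) simp
  then have clK: "closed (harmonic_map ` cball 0 \<rho>)" by (rule compact_imp_closed)
  have "closed {s \<in> {0..1}. H (s, t) \<in> harmonic_map ` cball 0 \<rho>}" if t: "t \<in> {0..1}" for t
  proof -
    have "continuous_on {0..1} (\<lambda>s. H (s, t))"
      by (rule continuous_on_compose2[OF contH]) (use t in \<open>auto intro!: continuous_intros\<close>)
    from continuous_closed_preimage[OF this _ clK] show ?thesis
      by (simp add: vimage_def Int_def conj_commute)
  qed
  then have clA: "closed A" unfolding A_eq by (intro closed_INT) auto
  have "closed (({0..1} \<times> {0..1}) \<inter> H -` (- (harmonic_map ` unit_disc)))"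
    by (intro continuous_closed_preimage contH closed_Compl open_harmonic_map_image closed_Times) auto
  then have "compact (({0..1} \<times> {0..1}) \<inter> (({0..1} \<times> {0..1}) \<inter> H -` (- (harmonic_map ` unit_disc))))"
    by (intro compact_Int_closed compact_Times) auto
  moreover have "({0..1} \<times> {0..1}) \<inter> (({0..1} \<times> {0..1}) \<inter> H -` (- (harmonic_map ` unit_disc))) =
      {x \<in> {0..1} \<times> {0..1}. H x \<in> - (harmonic_map ` unit_disc)}" by auto
  ultimately have "compact {x \<in> {0..1} \<times> {0..1}. H x \<in> - (harmonic_map ` unit_disc)}" by simp
  then have clB: "closed B"
    unfolding B_def
    by (intro compact_imp_closed compact_continuous_image) (auto intro!: continuous_intros)
  have B_eq: "B = {0..1} - A"
  proof (intro equalityI subsetI)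
    fix s assume "s \<in> {0..1} - A"
    then obtain t where "s \<in> {0..1}" "t \<in> {0..1}" "H (s, t) \<notin> harmonic_map ` unit_disc"
      unfolding A_def by blast
    then show "s \<in> B" unfolding B_def by (intro image_eqI[of _ _ "(s, t)"]) simp_all
  next
    fix s assume "s \<in> B"
    then obtain x where "x \<in> {0..1} \<times> {0..1}" "H x \<notin> harmonic_map ` unit_disc" "s = fst x"
      unfolding B_def by blast
    then have "s \<in> {0..1}" "snd x \<in> {0..1}" "H (s, snd x) \<notin> harmonic_map ` unit_disc"
      by (simp_all add: mem_Times_iff)
    then show "s \<in> {0..1} - A" unfolding A_def by blast
  qed
  then have AB: "A \<inter> B \<inter> {0..1} = {}" "{0..1} \<subseteq> A \<union> B" by auto
  have "0 \<in> A" using z assms by (auto simp: A_def H_def z_def)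
  then have "A \<inter> {0..1} \<noteq> {}" by auto
  with connected_closedD[OF connected_Icc AB(1) AB(2) clA clB] have "B \<inter> {0..1} = {}" by auto
  then have "{0..1} \<subseteq> A" using AB(2) by blast
  then have "1 \<in> A" by auto
  then have "(\<lambda>t. H (1, t)) ` {0..1} \<subseteq> harmonic_map ` cball 0 \<rho>" unfolding A_eq by auto
  then have "closed_segment (harmonic_map z1) (harmonic_map (z 1)) \<subseteq> harmonic_map ` cball 0 \<rho>"
    by (simp add: segH)
  then show "closed_segment y1 y2 \<subseteq> harmonic_map ` ball 0 r"
    using z \<rho>(2) by (auto simp: z_def)
qed

text \<open>
  The argument of the tangent is \<open>\<theta> u = pi / 2 + u + Im (Ln (1 - m u))\<close>, the principal logarithm
  being smooth because \<open>1 - m u\<close> stays in the right half-plane. In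
  \<open>\<theta>' = Re ((1 + m + k) / (1 - m))\<close> the part without \<open>k\<close> contributes
  \<open>(1 - (cmod m)\<^sup>2) / (cmod (1 - m))\<^sup>2\<close>, which outweighs the contribution of \<open>k\<close> as soon as
  \<open>cmod k \<le> 1 - cmod m\<close>.
\<close>

lemma convex_arc_harmonic_map:
  assumes "s < t" and "\<zeta> \<in> unit_disc" and "\<rho> > 0"
    and arc: "\<And>u. u \<in> {s..t} \<Longrightarrow> \<zeta> + of_real \<rho> * cis u \<in> unit_disc"
    and f: "\<And>z. z \<in> unit_disc \<Longrightarrow> f z = harmonic_map z"
  shows "convex_arc (\<lambda>u. f (\<zeta> + of_real \<rho> * cis u)) s t"
proof -
  define z where "z = (\<lambda>u. \<zeta> + of_real \<rho> * cis u)"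
  define m where "m = (\<lambda>u. cnj (deriv g (z u) * cis (2 * u)))"
  define k where "k = (\<lambda>u. cnj (deriv (deriv g) (z u) * of_real \<rho> * cis (3 * u)))"
  define \<theta> where "\<theta> = (\<lambda>u. pi / 2 + u + Im (Ln (1 - m u)))"
  have dcis: "((\<lambda>u. cis (c * u)) has_vector_derivative (of_real c * \<i> * cis (c * u))) (at u)"
    for c u :: real
    unfolding has_vector_derivative_complex_iff by (auto intro!: derivative_eq_intros)
  have dz: "(z has_vector_derivative (of_real \<rho> * (\<i> * cis u))) (at u)" for u
    unfolding z_def using dcis[of 1 u] by (auto intro!: derivative_eq_intros)
  have zD: "z u \<in> unit_disc" if "u \<in> {s..t}" for u
    using arc that by (simp add: z_def)
  have \<rho>2: "\<rho> \<le> 2"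
  proof -
    have "\<rho> = cmod (z s - \<zeta>)" using \<open>\<rho> > 0\<close> by (simp add: z_def norm_mult)
    also have "\<dots> \<le> cmod (z s) + cmod \<zeta>" by (rule norm_triangle_ineq4)
    also have "\<dots> \<le> 2" using zD[of s] assms(1,2) by simp
    finally show ?thesis .
  qed
  have m1: "cmod (m u) < 1" if "u \<in> {s..t}" for u
    using deriv_less_1[OF zD[OF that]] by (simp add: m_def norm_mult)
  have Re_pos: "Re (1 - m u) > 0" if "u \<in> {s..t}" for u
    using m1[OF that] complex_Re_le_cmod[of "m u"] by simp
  have k1: "cmod (k u) \<le> 1 - cmod (m u)" if "u \<in> {s..t}" for u
  proof -
    have "cmod (k u) = cmod (deriv (deriv g) (z u)) * \<rho>"
      using \<open>\<rho> > 0\<close> by (simp add: k_def norm_mult)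
    also have "\<dots> \<le> cmod (deriv (deriv g) (z u)) * 2"
      by (intro mult_left_mono \<rho>2) auto
    finally show ?thesis using deriv2_le[OF zD[OF that]] by (simp add: m_def norm_mult)
  qed
  have dm: "(m has_vector_derivative (- \<i> * (k u + 2 * m u))) (at u)" if u: "u \<in> {s..t}" for u
  proof -
    have "((\<lambda>u. deriv g (z u)) has_vector_derivative
        (of_real \<rho> * (\<i> * cis u) * deriv (deriv g) (z u))) (at u)"
      using field_vector_diff_chain_at[OF dz g_DERIV2[OF zD[OF u]]] by (simp add: o_def)
    from has_vector_derivative_cnj[OF has_vector_derivative_mult[OF this dcis[of 2 u]]]
    have "(m has_vector_derivative cnj (deriv g (z u) * (of_real 2 * \<i> * cis (2 * u)) +
        of_real \<rho> * (\<i> * cis u) * deriv (deriv g) (z u) * cis (2 * u))) (at u)"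
      by (simp add: m_def)
    moreover have "cis (3 * u) = cis u * cis (2 * u)" by (simp add: cis_mult)
    ultimately show ?thesis
      by (simp add: k_def m_def algebra_simps)
  qed
  have d\<theta>: "(\<theta> has_real_derivative Re ((1 + m u + k u) / (1 - m u))) (at u)"
    if u: "u \<in> {s..t}" for u
  proof -
    have nz: "1 - m u \<noteq> 0" using Re_pos[OF u] by auto
    have "1 - m u \<notin> \<real>\<^sub>\<le>\<^sub>0" using Re_pos[OF u] by (auto simp: complex_nonpos_Reals_iff)
    from field_vector_diff_chain_at[OF has_vector_derivative_diff[OF has_vector_derivative_const dm[OF u]]
           has_field_derivative_Ln[OF this]]
    have "((\<lambda>u. Ln (1 - m u)) has_vector_derivative
             (\<i> * (k u + 2 * m u) / (1 - m u))) (at u)"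
      by (simp add: o_def divide_inverse)
    then have "((\<lambda>u. Im (Ln (1 - m u))) has_real_derivative
             Im (\<i> * (k u + 2 * m u) / (1 - m u))) (at u)"
      by (simp add: has_vector_derivative_complex_iff)
    then have "(\<theta> has_real_derivative 1 + Im (\<i> * (k u + 2 * m u) / (1 - m u))) (at u)"
      unfolding \<theta>_def using DERIV_add[OF DERIV_add[OF DERIV_const DERIV_ident]] by fastforce
    also have "1 + Im (\<i> * (k u + 2 * m u) / (1 - m u)) = Re (1 + (k u + 2 * m u) / (1 - m u))"
      by (simp flip: times_divide_eq_right)
    also have "1 + (k u + 2 * m u) / (1 - m u) = (1 + m u + k u) / (1 - m u)"
      using nz by (simp add: field_simps)
    finally show ?thesis .
  qed
  have \<theta>'_nonneg: "Re ((1 + m u + k u) / (1 - m u)) \<ge> 0" if u: "u \<in> {s..t}" for u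
  proof -
    have "(1 + m u + k u) * cnj (1 - m u) =
        1 - m u * cnj (m u) + (m u - cnj (m u)) + k u * cnj (1 - m u)"
      by (simp add: algebra_simps)
    also have "m u * cnj (m u) = of_real ((cmod (m u))\<^sup>2)"
      by (rule complex_norm_square[symmetric])
    finally have "Re ((1 + m u + k u) * cnj (1 - m u)) =
        1 - (cmod (m u))\<^sup>2 + Re (k u * cnj (1 - m u))"
      by (simp del: complex_cnj_diff of_real_power)
    moreover have "- (cmod (k u) * cmod (1 - m u)) \<le> Re (k u * cnj (1 - m u))"
    proof -
      have "cmod (k u * cnj (1 - m u)) = cmod (k u) * cmod (1 - m u)"
        by (simp only: norm_mult complex_mod_cnj)
      then show ?thesis using abs_Re_le_cmod[of "k u * cnj (1 - m u)"] by linarith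
    qed
    moreover have "cmod (k u) * cmod (1 - m u) \<le> (1 - cmod (m u)) * (1 + cmod (m u))"
      using k1[OF u] m1[OF u] norm_triangle_ineq4[of 1 "m u"] by (intro mult_mono) auto
    moreover have "(1 - cmod (m u)) * (1 + cmod (m u)) = 1 - (cmod (m u))\<^sup>2"
      by (simp add: power2_eq_square algebra_simps)
    ultimately have "Re ((1 + m u + k u) * cnj (1 - m u)) \<ge> 0" by linarith
    then show ?thesis by (simp only: Re_complex_div_ge_0)
  qed
  show ?thesis
    unfolding convex_arc_def
  proof (intro exI[of _ \<theta>] conjI ballI)
    show "continuous_on {s..t} \<theta>"
    proof (rule continuous_at_imp_continuous_on, rule ballI)
      fix u assume "u \<in> {s..t}"
      from DERIV_isCont[OF d\<theta>[OF this]] show "isCont \<theta> u" .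
    qed
    show "mono_on {s..t} \<theta>"
    proof (rule mono_onI)
      fix x y assume xy: "x \<in> {s..t}" "y \<in> {s..t}" "x \<le> y"
      show "\<theta> x \<le> \<theta> y"
      proof (rule DERIV_nonneg_imp_nondecreasing[OF xy(3)])
        fix v assume "x \<le> v" "v \<le> y"
        then have v: "v \<in> {s..t}" using xy by simp
        from d\<theta>[OF v] \<theta>'_nonneg[OF v] show "\<exists>l. DERIV \<theta> v :> l \<and> l \<ge> 0" by blast
      qed
    qed
    fix u assume u: "u \<in> {s..t}"
    define R where "R = \<rho> * cmod (1 - m u)"
    have nz: "1 - m u \<noteq> 0" using Re_pos[OF u] by auto
    have R: "R > 0" using nz \<open>\<rho> > 0\<close> by (simp add: R_def)
    have "((\<lambda>u. g (z u)) has_vector_derivative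
        (of_real \<rho> * (\<i> * cis u) * deriv g (z u))) (at u)"
      using field_vector_diff_chain_at[OF dz g_DERIV[OF zD[OF u]]] by (simp add: o_def)
    from has_vector_derivative_add[OF dz has_vector_derivative_cnj[OF this]]
    have "((\<lambda>u. harmonic_map (z u)) has_vector_derivative
        (of_real \<rho> * (\<i> * cis u) + cnj (of_real \<rho> * (\<i> * cis u) * deriv g (z u)))) (at u)"
      by (simp add: harmonic_map_def)
    also have "of_real \<rho> * (\<i> * cis u) + cnj (of_real \<rho> * (\<i> * cis u) * deriv g (z u)) =
        of_real \<rho> * (\<i> * cis u) * (1 - m u)"
    proof -
      have "cis u * cnj (cis (2 * u)) = cnj (cis u)" by (simp add: cis_cnj cis_mult)
      then show ?thesis by (simp add: m_def algebra_simps)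
    qed
    also have "\<dots> = of_real R * cis (\<theta> u)"
    proof -
      have "1 - m u = exp (Ln (1 - m u))" using nz by simp
      also have "\<dots> = of_real (exp (Re (Ln (1 - m u)))) * cis (Im (Ln (1 - m u)))"
        by (rule exp_eq_polar)
      also have "exp (Re (Ln (1 - m u))) = cmod (1 - m u)"
        using nz by (simp del: right_minus_eq)
      finally have "1 - m u = of_real (cmod (1 - m u)) * cis (Im (Ln (1 - m u)))" .
      then have "of_real \<rho> * (\<i> * cis u) * (1 - m u) =
          of_real \<rho> * (\<i> * cis u) * (of_real (cmod (1 - m u)) * cis (Im (Ln (1 - m u))))"
        by (rule arg_cong)
      moreover have "cis (\<theta> u) = \<i> * cis u * cis (Im (Ln (1 - m u)))"
        by (simp only: \<theta>_def cis_mult[symmetric] cis_pi_half)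
      ultimately show ?thesis by (simp only: R_def of_real_mult mult_ac)
    qed
    finally have "((\<lambda>u. harmonic_map (z u)) has_vector_derivative of_real R * cis (\<theta> u)) (at u within {s..t})"
      by (rule has_vector_derivative_at_within)
    then have "((\<lambda>u. f (z u)) has_vector_derivative of_real R * cis (\<theta> u)) (at u within {s..t})"
      by (rule has_vector_derivative_transform[OF u, rotated]) (rule f[OF zD])
    then show "\<exists>R>0. ((\<lambda>u. f (\<zeta> + of_real \<rho> * cis u)) has_vector_derivative
        of_real R * cis (\<theta> u)) (at u within {s..t})"
      using R by (auto simp: z_def)
  qed
qed

lemma harmonic_parts_harmonic_map:
  assumes "g 0 = 0" and f: "\<And>z. z \<in> unit_disc \<Longrightarrow> f z = harmonic_map z"
  shows "harmonic_parts f (\<lambda>z. z) g"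
  unfolding harmonic_parts_def
proof (intro conjI)
  show "\<exists>a. a 0 = 0 \<and> a 1 = 1 \<and> (\<forall>z\<in>unit_disc. (\<lambda>n. a n * z ^ n) sums z)"
  proof (intro exI[of _ "\<lambda>n. if n = 1 then 1 else 0"] conjI ballI)
    fix z :: complex
    show "(\<lambda>n. (if n = 1 then 1 else 0) * z ^ n) sums z"
      using sums_If_finite_set[of "{1}" "\<lambda>n. z ^ n"] by (simp add: if_distrib[of "\<lambda>x. x * _"] cong: if_cong)
  qed auto
  show "\<exists>b. b 0 = 0 \<and> (\<forall>z\<in>unit_disc. (\<lambda>n. b n * z ^ n) sums g z)"
    using holomorphic_power_series[OF holo] assms(1)
    by (intro exI[of _ "\<lambda>n. (deriv ^^ n) g 0 / fact n"]) auto
qed (use holo f in \<open>auto simp: harmonic_map_def\<close>)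

theorem in_class_UKH:
  assumes "g 0 = 0" and f: "\<And>z. z \<in> unit_disc \<Longrightarrow> f z = harmonic_map z"
  shows "f \<in> class_UKH"
proof -
  have parts: "harmonic_parts f (\<lambda>z. z) g"
    using assms by (rule harmonic_parts_harmonic_map)
  have inj: "inj_on f unit_disc"
    using inj_on_harmonic_map inj_on_cong[of unit_disc f harmonic_map] f by blast
  have "(cmod (deriv (\<lambda>z. z) z))\<^sup>2 - (cmod (deriv g z))\<^sup>2 > 0" if "z \<in> unit_disc" for z
    using deriv_less_1[OF that] by (simp add: abs_square_less_1)
  then have SH: "f \<in> class_SH"
    using parts inj unfolding class_SH_def by blast
  have img: "f ` ball 0 r = harmonic_map ` ball 0 r" if "r < 1" for r
    using that by (intro image_cong f) auto
  have "locally_univalent f"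
    unfolding locally_univalent_def
    by (intro ballI exI[of _ 1] conjI inj_on_subset[OF inj]) auto
  then have "fully_convex f"
    using parts open_harmonic_map_image convex_harmonic_map_image
    unfolding fully_convex_def class_H_def by (auto simp: img)
  then have "uniformly_convex f"
    unfolding uniformly_convex_def using convex_arc_harmonic_map[OF _ _ _ _ f] by blast
  with SH show ?thesis by (simp add: class_UKH_def)
qed

end

section \<open>A coefficient criterion for uniform convexity\<close>

lemma norm_power_term_le:
  fixes c z :: complex
  assumes "z \<in> unit_disc"
  shows "norm (c * z ^ n) \<le> norm c"
proof -
  have "norm c * norm z ^ n \<le> norm c * 1"
    using assms by (intro mult_left_mono power_le_one) auto
  then show ?thesis by (simp add: norm_mult norm_power)
qed

lemma summable_norm_imp_summable_power_series:
  fixes c :: "nat \<Rightarrow> complex"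
  assumes "summable (\<lambda>n. norm (c n))" and "z \<in> unit_disc"
  shows "summable (\<lambda>n. norm (c n * z ^ n))"
proof (rule summable_comparison_test'[OF assms(1)])
  show "norm (norm (c n * z ^ n)) \<le> norm (c n)" for n
    using norm_power_term_le[OF assms(2)] by simp
qed

lemma norm_power_series_le:
  fixes c :: "nat \<Rightarrow> complex"
  assumes "summable (\<lambda>n. norm (c n))" and "z \<in> unit_disc"
  shows "norm (\<Sum>n. c n * z ^ n) \<le> (\<Sum>n. norm (c n))"
  using norm_power_term_le[OF assms(2)] assms(1) by (rule norm_suminf_le)

lemma power_series_Suc_has_derivative:
  fixes d :: "nat \<Rightarrow> complex"
  assumes "summable (\<lambda>n. norm (of_nat (Suc n) * d n))" and "z \<in> unit_disc"
  shows "((\<lambda>z. \<Sum>n. d n * z ^ Suc n) has_field_derivative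
           (\<Sum>n. of_nat (Suc n) * d n * z ^ n)) (at z)"
proof -
  define c where "c = (\<lambda>n. if n = 0 then 0 else d (n - 1))"
  have sm: "summable (\<lambda>n. norm (d n))"
  proof (rule summable_comparison_test'[OF assms(1)])
    fix n
    have "1 * norm (d n) \<le> real (Suc n) * norm (d n)" by (intro mult_right_mono) auto
    then show "norm (norm (d n)) \<le> norm (of_nat (Suc n) * d n)"
      by (simp only: norm_mult norm_of_nat) simp
  qed
  have smc: "summable (\<lambda>n. norm (c n))"
    using sm by (subst summable_Suc_iff[symmetric]) (simp add: c_def)
  have eq: "(\<Sum>n. c n * x ^ n) = (\<Sum>n. d n * x ^ Suc n)" if "x \<in> unit_disc" for x
    using suminf_split_head[OF summable_norm_cancel[OF
            summable_norm_imp_summable_power_series[OF smc that]]]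
    by (simp add: c_def)
  have "((\<lambda>z. \<Sum>n. c n * z ^ n) has_field_derivative (\<Sum>n. diffs c n * z ^ n)) (at z)"
    by (rule termdiffs_strong[where K = 1]) (use summable_norm_cancel[OF smc] assms(2) in auto)
  then have "((\<lambda>z. \<Sum>n. d n * z ^ Suc n) has_field_derivative (\<Sum>n. diffs c n * z ^ n)) (at z)"
    by (rule has_field_derivative_transform_within_open[where S = unit_disc])
       (use assms(2) eq in auto)
  then show ?thesis by (simp add: diffs_def c_def)
qed

text \<open>
  The weight splits as \<open>(n + 1) * (2 * n + 1) = (n + 1) + 2 * n * (n + 1)\<close>, the coefficient bounds for
  \<open>g'\<close> and for twice \<open>g''\<close>. Moreover \<open>n + 1\<close> is at most a third of the weight when \<open>n > 0\<close>. So if the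
  total weight is at most 1, then \<open>g'\<close> is bounded by
  \<open>cmod (d 0) + (1 - cmod (d 0)) / 3\<close>, which is less than 1.
\<close>

lemma small_antianalytic_part_power_series:
  fixes d :: "nat \<Rightarrow> complex"
  assumes sm: "summable (\<lambda>n. real ((n + 1) * (2 * n + 1)) * cmod (d n))"
    and le1: "(\<Sum>n. real ((n + 1) * (2 * n + 1)) * cmod (d n)) \<le> 1"
    and d0: "cmod (d 0) < 1"
  shows "small_antianalytic_part (\<lambda>z. \<Sum>n. d n * z ^ Suc n) ((1 + 2 * cmod (d 0)) / 3)"
proof -
  define w where "w = (\<lambda>n. real ((n + 1) * (2 * n + 1)) * cmod (d n))"
  define g where "g = (\<lambda>z. \<Sum>n. d n * z ^ Suc n)"
  define c1 where "c1 = (\<lambda>n. of_nat (Suc n) * d n)"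
  define c2 where "c2 = diffs c1"
  have n1: "norm (c1 n) = real (n + 1) * cmod (d n)" for n
    by (simp only: c1_def norm_mult norm_of_nat) simp
  have n2: "norm (c2 n) = real (n + 1) * real (n + 2) * cmod (d (Suc n))" for n
    by (simp only: c2_def c1_def diffs_def norm_mult norm_of_nat) simp
  have w_eq: "w n = norm (c1 n) + 2 * (real n * real (n + 1) * cmod (d n))" for n
    by (simp add: w_def n1 algebra_simps)
  have sm1: "summable (\<lambda>n. norm (c1 n))"
    by (rule summable_comparison_test'[OF sm[folded w_def]]) (simp add: w_eq)
  have sm2': "summable (\<lambda>n. real n * real (n + 1) * cmod (d n))"
  proof (rule summable_comparison_test'[OF sm[folded w_def]])
    fix n
    have "0 \<le> real n * real (n + 1) * cmod (d n)" by simp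
    then show "norm (real n * real (n + 1) * cmod (d n)) \<le> w n"
      unfolding w_eq real_norm_def by (simp only: abs_of_nonneg) (smt (verit) norm_ge_zero)
  qed
  then have sm2: "summable (\<lambda>n. norm (c2 n))"
    by (subst (asm) summable_Suc_iff[symmetric]) (simp add: n2 add_ac)
  have B: "(\<Sum>n. norm (c2 n)) = (\<Sum>n. real n * real (n + 1) * cmod (d n))"
    using suminf_split_head[OF sm2'] by (simp add: n2 add_ac)
  have AB: "(\<Sum>n. norm (c1 n)) + 2 * (\<Sum>n. norm (c2 n)) \<le> 1"
  proof -
    have "suminf w = (\<Sum>n. norm (c1 n) + 2 * (real n * real (n + 1) * cmod (d n)))"
      by (intro suminf_cong w_eq)
    also have "\<dots> = (\<Sum>n. norm (c1 n)) + 2 * (\<Sum>n. norm (c2 n))"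
      unfolding B
      by (simp only: suminf_add[OF sm1 summable_mult[OF sm2'], symmetric] suminf_mult[OF sm2'])
    finally show ?thesis using le1 by (simp add: w_def)
  qed
  have A: "(\<Sum>n. norm (c1 n)) \<le> (1 + 2 * cmod (d 0)) / 3"
  proof -
    \<comment> \<open>A third of the weight falls short of \<open>n + 1\<close> only at \<open>n = 0\<close>; \<open>e\<close> makes up the difference.\<close>
    define e where "e = (\<lambda>n::nat. if n = 0 then 2 / 3 * cmod (d 0) else 0)"
    have e: "e sums (2 / 3 * cmod (d 0))"
      using sums_If_finite_set[of "{0}" "\<lambda>_. 2 / 3 * cmod (d 0)"] by (simp add: e_def)
    have ws: "(\<lambda>n. w n / 3) sums (suminf w / 3)"
      using sm by (intro sums_divide summable_sums) (simp add: w_def)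
    have "norm (c1 n) \<le> w n / 3 + e n" for n
    proof (cases "n = 0")
      case True then show ?thesis by (simp add: n1 w_def e_def)
    next
      case False
      then have "3 * real (n + 1) \<le> real (2 * n + 1) * real (n + 1)"
        by (intro mult_right_mono of_nat_0_le_iff) (simp add: Suc_le_eq)
      then have "3 * real (n + 1) * cmod (d n) \<le> real (2 * n + 1) * real (n + 1) * cmod (d n)"
        by (rule mult_right_mono) simp
      then have "3 * norm (c1 n) \<le> w n" by (simp add: n1 w_def algebra_simps)
      with False show ?thesis by (simp add: e_def)
    qed
    then have "(\<Sum>n. norm (c1 n)) \<le> suminf w / 3 + 2 / 3 * cmod (d 0)"
      using sums_le[OF _ summable_sums[OF sm1] sums_add[OF ws e]] by blast
    then show ?thesis using le1 unfolding w_def[symmetric] by simp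
  qed
  have dg: "(g has_field_derivative (\<Sum>n. c1 n * z ^ n)) (at z)" if "z \<in> unit_disc" for z
    using power_series_Suc_has_derivative[OF sm1[unfolded c1_def] that] by (simp add: g_def c1_def)
  have dg2: "(deriv g has_field_derivative (\<Sum>n. c2 n * z ^ n)) (at z)" if "z \<in> unit_disc" for z
  proof -
    have "((\<lambda>z. \<Sum>n. c1 n * z ^ n) has_field_derivative (\<Sum>n. c2 n * z ^ n)) (at z)"
      unfolding c2_def
      by (rule termdiffs_strong[where K = 1]) (use summable_norm_cancel[OF sm1] that in auto)
    then show ?thesis
      by (rule has_field_derivative_transform_within_open[where S = unit_disc])
         (use that DERIV_imp_deriv[OF dg] in auto)
  qed
  have "small_antianalytic_part g ((1 + 2 * cmod (d 0)) / 3)"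
  proof
    show "g holomorphic_on unit_disc"
      using dg by (subst holomorphic_on_open) blast+
    show "(1 + 2 * cmod (d 0)) / 3 < 1" using d0 by simp
    fix z :: complex assume z: "z \<in> unit_disc"
    have 1: "cmod (deriv g z) \<le> (\<Sum>n. norm (c1 n))"
      using norm_power_series_le[OF sm1 z] by (simp add: DERIV_imp_deriv[OF dg[OF z]])
    have 2: "cmod (deriv (deriv g) z) \<le> (\<Sum>n. norm (c2 n))"
      using norm_power_series_le[OF sm2 z] by (simp add: DERIV_imp_deriv[OF dg2[OF z]])
    show "cmod (deriv g z) \<le> (1 + 2 * cmod (d 0)) / 3" using 1 A by linarith
    show "cmod (deriv g z) + 2 * cmod (deriv (deriv g) z) \<le> 1" using 1 2 AB by linarith
  qed
  then show ?thesis by (simp add: g_def)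
qed

theorem power_series_in_class_UKH:
  fixes d :: "nat \<Rightarrow> complex"
  assumes w: "(\<lambda>n. real ((n + 1) * (2 * n + 1)) * cmod (d n)) sums w"
    and "w \<le> 1" and d0: "cmod (d 0) < 1"
    and f: "\<And>z. z \<in> unit_disc \<Longrightarrow> f z = z + cnj (\<Sum>n. d n * z ^ Suc n)"
  shows "f \<in> class_UKH"
proof -
  interpret small_antianalytic_part "\<lambda>z. \<Sum>n. d n * z ^ Suc n" "(1 + 2 * cmod (d 0)) / 3"
    using assms by (intro small_antianalytic_part_power_series) (auto simp: sums_iff)
  show ?thesis
  proof (rule in_class_UKH)
    fix z :: complex assume "z \<in> unit_disc"
    then show "f z = harmonic_map z" unfolding harmonic_map_def by (rule f)
  qed simp
qed

section \<open>Hypergeometric examples\<close>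

(* Under the hypotheses on a, b, c the left-hand sides of the three inequalities are real;
   Re only converts the type.
   The excluded case in the second part is degenerate: for a = b = -1 one has F(a,b;c;z) = 1 + z/c,
   so |alpha| = 2c gives equality in the inequality while f2 z = z + cnj (u * z) with |u| = 1,
   which is not univalent. *)
theorem theorem8:
  fixes a b \<alpha> :: complex and c :: real and f1 f2 f3 :: "complex \<Rightarrow> complex"
  assumes "(a \<in> \<real> \<and> b \<in> \<real> \<and> Re a > -1 \<and> Re b > -1 \<and> Re (a * b) > 0) \<or>
           (a \<noteq> 0 \<and> b \<noteq> 0 \<and> b = cnj a)"
    and "c > 0"
    and "\<alpha> \<in> unit_disc"
    and "\<And>z. z \<in> unit_disc \<Longrightarrow>
           f1 z = z + cnj (\<alpha> / 2 * z * hypergeom a b c z)"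
    and "\<And>z. z \<in> unit_disc \<Longrightarrow>
           f2 z = z + cnj (\<alpha> / 2 * (hypergeom a b c z - 1))"
    and "\<And>z. z \<in> unit_disc \<Longrightarrow>
           f3 z = z + cnj (\<alpha> / 2 * contour_integral (linepath 0 z) (hypergeom a b c))"
  shows "(c > Re (a + b) + 2 \<and>
          Re (cmod \<alpha> * (Gamma c * Gamma (c - a - b) / (Gamma (c - a) * Gamma (c - b))) *
              (2 * pochhammer a 2 * pochhammer b 2 / pochhammer (c - a - b - 2) 2
               + 5 * a * b / (c - a - b - 1) + 1)) \<le> 2
          \<longrightarrow> f1 \<in> class_UKH) \<and>
         (c > Re (a + b) + 2 \<and>
          \<not> (a = -1 \<and> b = -1 \<and> cmod \<alpha> = 2 * c) \<and>
          Re (a * b * cmod \<alpha> * (Gamma c * Gamma (c - a - b - 1) / (Gamma (c - a) * Gamma (c - b))) *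
              ((a + b + c + 2 * a * b) / (c - a - b - 2))) \<le> 2
          \<longrightarrow> f2 \<in> class_UKH) \<and>
         (c > Re (a + b) + 1 \<and>
          Re (cmod \<alpha> * (Gamma c * Gamma (c - a - b) / (Gamma (c - a) * Gamma (c - b))) *
              ((2 * a * b + c - a - b - 1) / (c - a - b - 1))) \<le> 2
          \<longrightarrow> f3 \<in> class_UKH)"
proof -
  define C where "C = complex_of_real c"
  define A where "A = hyp_coeff a b C"
  define G where "G = gauss_value a b C"
  define s where "s = C - a - b"
  have C: "C \<notin> \<int>\<^sub>\<le>\<^sub>0" "C \<noteq> 0"
    using assms(2) Re_pos_not_nonpos_Int[of C] by (auto simp: C_def)
  have G_eq: "G = Gamma c * Gamma (c - a - b) / (Gamma (c - a) * Gamma (c - b))"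
    by (simp add: G_def gauss_value_def C_def Gamma_complex_of_real)
  have A_nonneg: "A n = of_real (cmod (A n))" for n
    unfolding A_def C_def by (rule hyp_coeff_eq_cmod) (use assms(1,2) in auto)
  have \<alpha>1: "cmod \<alpha> < 1" using assms(3) by simp
  have S0: "A sums G" if "Re s > 0"
    unfolding A_def G_def using C that by (intro gauss_summation) (auto simp: s_def)
  have S1: "(\<lambda>n. of_nat n * A n) sums (a * b / (s - 1) * G)" if "Re s > 1"
    unfolding A_def G_def s_def
    using C that by (intro hyp_coeff_first_moment) (auto simp: s_def)
  have S2: "(\<lambda>n. of_nat n * (of_nat n - 1) * A n) sums
      (pochhammer a 2 * pochhammer b 2 / pochhammer (s - 2) 2 * G)" if "Re s > 2"
    unfolding A_def G_def s_def
    using C that by (intro hyp_coeff_second_factorial_moment) (auto simp: s_def)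
  have smA: "summable (\<lambda>n. norm (A n))" if "Re s > 0"
    unfolding A_def using C that by (intro summable_norm_hyp_coeff) (auto simp: s_def)
  have real_sums: "(\<lambda>n. w n * cmod (A n)) sums Re T"
    if "(\<lambda>n. of_real (w n) * A n) sums T" for w T
    using sums_Re[OF that] by (subst (asm) A_nonneg) simp
  have half: "r / 2 * Re T \<le> 1 \<longleftrightarrow> Re (of_real r * T) \<le> 2" for r T
    by simp
  have F_eq: "hypergeom a b c = (\<lambda>z. \<Sum>n. A n * z ^ n)"
    by (simp add: fun_eq_iff hypergeom_eq_suminf A_def C_def)
  have smF: "summable (\<lambda>n. A n * z ^ n)" if "Re s > 0" "z \<in> unit_disc" for z
    using summable_norm_cancel[OF summable_norm_imp_summable_power_series[OF smA]] that by blast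

  \<comment> \<open>\<open>(n + 1) * (2 * n + 1) = 2 * n * (n - 1) + 5 * n + 1\<close> splits the weight into factorial moments.\<close>
  have part_a: "f1 \<in> class_UKH"
    if s2: "Re s > 2"
      and le: "Re (cmod \<alpha> * G * (2 * pochhammer a 2 * pochhammer b 2 / pochhammer (s - 2) 2
               + 5 * a * b / (s - 1) + 1)) \<le> 2"
  proof (rule power_series_in_class_UKH)
    let ?T = "2 * (pochhammer a 2 * pochhammer b 2 / pochhammer (s - 2) 2 * G)
              + 5 * (a * b / (s - 1) * G) + G"
    have "(\<lambda>n. 2 * (of_nat n * (of_nat n - 1) * A n) + 5 * (of_nat n * A n) + A n) sums ?T"
      using s2 by (intro sums_add sums_mult S0 S1 S2) auto
    also have "(\<lambda>n. 2 * (of_nat n * (of_nat n - 1) * A n) + 5 * (of_nat n * A n) + A n) =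
        (\<lambda>n. of_real (real ((n + 1) * (2 * n + 1))) * A n)"
      by (auto simp: algebra_simps)
    finally have "(\<lambda>n. cmod \<alpha> / 2 * (real ((n + 1) * (2 * n + 1)) * cmod (A n))) sums
        (cmod \<alpha> / 2 * Re ?T)"
      by (intro sums_mult real_sums)
    then show "(\<lambda>n. real ((n + 1) * (2 * n + 1)) * cmod (\<alpha> / 2 * A n)) sums
        (cmod \<alpha> / 2 * Re ?T)"
      by (simp add: norm_mult norm_divide mult_ac)
    have "cmod \<alpha> * G * (2 * pochhammer a 2 * pochhammer b 2 / pochhammer (s - 2) 2
               + 5 * a * b / (s - 1) + 1) = of_real (cmod \<alpha>) * ?T"
      by (simp add: algebra_simps)
    with le have "Re (of_real (cmod \<alpha>) * ?T) \<le> 2" by (simp only:)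
    then show "cmod \<alpha> / 2 * Re ?T \<le> 1" by (simp only: half)
    show "cmod (\<alpha> / 2 * A 0) < 1" using \<alpha>1 by (simp add: A_def norm_divide)
    fix z assume z: "z \<in> unit_disc"
    have "(\<Sum>n. \<alpha> / 2 * A n * z ^ Suc n) = (\<Sum>n. \<alpha> / 2 * z * (A n * z ^ n))"
      by (simp add: mult_ac)
    also have "\<dots> = \<alpha> / 2 * z * hypergeom a b c z"
      unfolding F_eq using s2 z by (intro suminf_mult smF) auto
    finally show "f1 z = z + cnj (\<Sum>n. \<alpha> / 2 * A n * z ^ Suc n)"
      using assms(4)[OF z] by (simp only:)
  qed

  \<comment> \<open>After the index shift the weight is \<open>n * (2 * n - 1) = 2 * n * (n - 1) + n\<close>.\<close>
  have part_b: "f2 \<in> class_UKH"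
    if s2: "Re s > 2" and nondeg: "\<not> (a = -1 \<and> b = -1 \<and> cmod \<alpha> = 2 * c)"
      and le: "Re (a * b * cmod \<alpha> * (Gamma c * Gamma (s - 1) / (Gamma (c - a) * Gamma (c - b))) *
              ((a + b + c + 2 * a * b) / (s - 2))) \<le> 2"
  proof -
    let ?T = "2 * (pochhammer a 2 * pochhammer b 2 / pochhammer (s - 2) 2 * G)
              + a * b / (s - 1) * G"
    define d where "d = (\<lambda>n. \<alpha> / 2 * A (Suc n))"
    have "(\<lambda>n. 2 * (of_nat n * (of_nat n - 1) * A n) + of_nat n * A n) sums ?T"
      using s2 by (intro sums_add sums_mult S1 S2) auto
    also have "(\<lambda>n. 2 * (of_nat n * (of_nat n - 1) * A n) + of_nat n * A n) =
        (\<lambda>n. of_real (real n * (2 * real n - 1)) * A n)"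
      by (auto simp: algebra_simps)
    finally have "(\<lambda>n. real n * (2 * real n - 1) * cmod (A n)) sums Re ?T"
      by (rule real_sums)
    then have "(\<lambda>n. real (Suc n) * (2 * real (Suc n) - 1) * cmod (A (Suc n))) sums Re ?T"
      by (subst sums_Suc_iff) simp
    then have "(\<lambda>n. cmod \<alpha> / 2 * (real (Suc n) * (2 * real (Suc n) - 1) * cmod (A (Suc n)))) sums
        (cmod \<alpha> / 2 * Re ?T)"
      by (rule sums_mult)
    then have sums: "(\<lambda>n. real ((n + 1) * (2 * n + 1)) * cmod (d n)) sums (cmod \<alpha> / 2 * Re ?T)"
      by (simp add: d_def norm_mult norm_divide algebra_simps)
    have "a * b * cmod \<alpha> * (Gamma c * Gamma (s - 1) / (Gamma (c - a) * Gamma (c - b))) *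
              ((a + b + c + 2 * a * b) / (s - 2)) = of_real (cmod \<alpha>) * ?T"
    proof -
      define H where "H = Gamma c * Gamma (s - 1) / (Gamma (c - a) * Gamma (c - b))"
      have nz: "s - 1 \<noteq> 0" "s - 2 \<noteq> 0" using s2 by auto
      have "s - 1 \<notin> \<int>\<^sub>\<le>\<^sub>0" using s2 by (intro Re_pos_not_nonpos_Int) simp
      then have "Gamma s = (s - 1) * Gamma (s - 1)"
        using Gamma_plus1[of "s - 1"] by simp
      then have GH: "G = (s - 1) * H" by (simp add: G_eq H_def s_def C_def)
      have p: "pochhammer (s - 2) 2 = (s - 2) * (s - 1)"
        by (simp add: numeral_2_eq_2 pochhammer_Suc)
      have "?T = a * b * H * (2 * (a + 1) * (b + 1) / (s - 2) + 1)"
        using nz unfolding GH p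
        by (simp add: numeral_2_eq_2 pochhammer_Suc divide_simps) (simp add: algebra_simps)
      also have "2 * (a + 1) * (b + 1) / (s - 2) + 1 = (a + b + c + 2 * a * b) / (s - 2)"
        using nz by (simp add: divide_simps s_def C_def) (simp add: algebra_simps)
      finally show ?thesis by (simp add: H_def mult_ac)
    qed
    with le have "Re (of_real (cmod \<alpha>) * ?T) \<le> 2" by (simp only:)
    then have le1: "cmod \<alpha> / 2 * Re ?T \<le> 1" by (simp only: half)
    \<comment> \<open>Equality would use up the whole weight, so \<open>A 2 = 0\<close> and \<open>a = b = -1\<close>, the excluded case.\<close>
    have "cmod (d 0) < 1"
    proof (rule ccontr)
      assume "\<not> cmod (d 0) < 1"
      moreover have "cmod (d 0) + 6 * cmod (d 1) \<le> 1"
        using sum_le_suminf[of "\<lambda>n. real ((n + 1) * (2 * n + 1)) * cmod (d n)" "{0, 1}"] sums le1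
        by (auto simp: sums_iff)
      moreover have "cmod (d 1) \<ge> 0" by simp
      ultimately have d: "cmod (d 0) = 1" and "cmod (d 1) = 0" by linarith+
      then have "d 1 = 0" by simp
      with d have "\<alpha> \<noteq> 0" "A 2 = 0" by (auto simp: d_def numeral_2_eq_2)
      have "pochhammer C 2 \<noteq> 0" using C by (auto simp: pochhammer_eq_0_iff)
      with \<open>A 2 = 0\<close> have "a * (a + 1) * (b * (b + 1)) = 0"
        by (simp add: A_def hyp_coeff_def numeral_2_eq_2 pochhammer_Suc)
      then have "a = -1 \<or> b = -1"
        using assms(1) by (auto simp: add_eq_0_iff2)
      then have ab: "a = -1" "b = -1"
        using assms(1) by (auto simp: complex_eq_iff)
      then have "cmod (d 0) = cmod \<alpha> / (2 * c)"
        using assms(2) by (simp add: d_def A_def hyp_coeff_def C_def norm_mult norm_divide)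
      with d have "cmod \<alpha> = 2 * c" using assms(2) by (simp add: field_simps)
      with nondeg ab show False by simp
    qed
    with sums le1 show ?thesis
    proof (rule power_series_in_class_UKH)
      fix z assume z: "z \<in> unit_disc"
      have "(\<Sum>n. d n * z ^ Suc n) = (\<Sum>n. \<alpha> / 2 * (A (Suc n) * z ^ Suc n))"
        by (simp add: d_def mult_ac)
      also have "\<dots> = \<alpha> / 2 * (\<Sum>n. A (Suc n) * z ^ Suc n)"
        by (intro suminf_mult) (use s2 smF[OF _ z] summable_Suc_iff[of "\<lambda>n. A n * z ^ n"] in auto)
      also have "(\<Sum>n. A (Suc n) * z ^ Suc n) = hypergeom a b c z - 1"
        using suminf_split_head[OF smF[OF _ z]] s2 by (simp add: F_eq A_def)
      finally show "f2 z = z + cnj (\<Sum>n. d n * z ^ Suc n)"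
        using assms(5)[OF z] by (simp only:)
    qed
  qed

  \<comment> \<open>Integration cancels the factor \<open>n + 1\<close> and leaves the weight \<open>2 * n + 1\<close>.\<close>
  have part_c: "f3 \<in> class_UKH"
    if s1: "Re s > 1"
      and le: "Re (cmod \<alpha> * G * ((2 * a * b + c - a - b - 1) / (s - 1))) \<le> 2"
  proof (rule power_series_in_class_UKH)
    let ?T = "2 * (a * b / (s - 1) * G) + G"
    have "(\<lambda>n. 2 * (of_nat n * A n) + A n) sums ?T"
      using s1 by (intro sums_add sums_mult S0 S1) auto
    also have "(\<lambda>n. 2 * (of_nat n * A n) + A n) = (\<lambda>n. of_real (2 * real n + 1) * A n)"
      by (auto simp: algebra_simps)
    finally have "(\<lambda>n. cmod \<alpha> / 2 * ((2 * real n + 1) * cmod (A n))) sums (cmod \<alpha> / 2 * Re ?T)"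
      by (intro sums_mult real_sums)
    also have "(\<lambda>n. cmod \<alpha> / 2 * ((2 * real n + 1) * cmod (A n))) =
        (\<lambda>n. real ((n + 1) * (2 * n + 1)) * cmod (\<alpha> / 2 * (A n / of_nat (Suc n))))"
    proof
      fix n
      have "cmod (\<alpha> / 2 * (A n / of_nat (Suc n))) = cmod \<alpha> / 2 * cmod (A n) / real (Suc n)"
        by (simp add: norm_mult norm_divide del: of_nat_Suc)
      moreover have "real ((n + 1) * (2 * n + 1)) = real (Suc n) * (2 * real n + 1)"
        by (simp add: algebra_simps)
      ultimately show "cmod \<alpha> / 2 * ((2 * real n + 1) * cmod (A n)) =
          real ((n + 1) * (2 * n + 1)) * cmod (\<alpha> / 2 * (A n / of_nat (Suc n)))"
        by (simp del: of_nat_Suc)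
    qed
    finally show "(\<lambda>n. real ((n + 1) * (2 * n + 1)) * cmod (\<alpha> / 2 * (A n / of_nat (Suc n))))
        sums (cmod \<alpha> / 2 * Re ?T)" .
    have "s - 1 \<noteq> 0" using s1 by auto
    then have "?T = G * ((2 * a * b + c - a - b - 1) / (s - 1))"
      by (simp add: divide_simps s_def C_def) (simp add: algebra_simps)
    then have "cmod \<alpha> * G * ((2 * a * b + c - a - b - 1) / (s - 1)) = of_real (cmod \<alpha>) * ?T"
      by (simp only: mult.assoc)
    with le have "Re (of_real (cmod \<alpha>) * ?T) \<le> 2" by (simp only:)
    then show "cmod \<alpha> / 2 * Re ?T \<le> 1" by (simp only: half)
    show "cmod (\<alpha> / 2 * (A 0 / of_nat (Suc 0))) < 1" using \<alpha>1 by (simp add: A_def norm_divide)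
    fix z assume z: "z \<in> unit_disc"
    define I where "I = (\<lambda>z. \<Sum>n. A n / of_nat (Suc n) * z ^ Suc n)"
    have dI: "(I has_field_derivative hypergeom a b c x) (at x)" if "x \<in> unit_disc" for x
      using power_series_Suc_has_derivative[of "\<lambda>n. A n / of_nat (Suc n)" x] smA s1 that
      by (simp add: I_def F_eq del: of_nat_Suc)
    have "(hypergeom a b c has_contour_integral (I (pathfinish (linepath 0 z)) -
        I (pathstart (linepath 0 z)))) (linepath 0 z)"
    proof (rule contour_integral_primitive[where S = unit_disc])
      show "path_image (linepath 0 z) \<subseteq> unit_disc"
        using z by (simp add: closed_segment_subset)
    qed (rule has_field_derivative_at_within[OF dI] valid_path_linepath | assumption)+
    then have int: "contour_integral (linepath 0 z) (hypergeom a b c) = I z"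
      by (simp add: contour_integral_unique I_def)
    have "summable (\<lambda>n. A n / of_nat (Suc n) * z ^ Suc n)"
    proof (rule summable_comparison_test'[OF smA])
      fix n
      have "cmod z ^ Suc n \<le> 1" using z by (intro power_le_one) auto
      then have "cmod z ^ Suc n / real (Suc n) \<le> 1"
        by (simp add: divide_le_eq del: power_Suc)
      then have "cmod (A n) * (cmod z ^ Suc n / real (Suc n)) \<le> cmod (A n) * 1"
        by (intro mult_left_mono) auto
      then show "cmod (A n / of_nat (Suc n) * z ^ Suc n) \<le> cmod (A n)"
        by (simp add: norm_mult norm_divide norm_power del: of_nat_Suc)
    qed (use s1 in simp)
    from suminf_mult[OF this, of "\<alpha> / 2"]
    have "(\<Sum>n. \<alpha> / 2 * (A n / of_nat (Suc n)) * z ^ Suc n) = \<alpha> / 2 * I z"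
      by (simp add: I_def mult.assoc del: of_nat_Suc)
    then show "f3 z = z + cnj (\<Sum>n. \<alpha> / 2 * (A n / of_nat (Suc n)) * z ^ Suc n)"
      using assms(6)[OF z] int by (simp only:)
  qed

  have s: "complex_of_real c - a - b = s" by (simp add: s_def C_def)
  have Re_s: "Re s = c - Re (a + b)" by (simp add: s_def C_def)
  show ?thesis
    unfolding s G_eq[unfolded s, symmetric]
  proof (intro conjI impI; elim conjE)
    assume "c > Re (a + b) + 2"
    then have "Re s > 2" using Re_s by linarith
    then show "f1 \<in> class_UKH"
      if "Re (cmod \<alpha> * G * (2 * pochhammer a 2 * pochhammer b 2 / pochhammer (s - 2) 2
               + 5 * a * b / (s - 1) + 1)) \<le> 2"
      using that by (rule part_a)
    from \<open>Re s > 2\<close> show "f2 \<in> class_UKH"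
      if "\<not> (a = -1 \<and> b = -1 \<and> cmod \<alpha> = 2 * c)"
        and "Re (a * b * cmod \<alpha> * (Gamma c * Gamma (s - 1) / (Gamma (c - a) * Gamma (c - b))) *
              ((a + b + c + 2 * a * b) / (s - 2))) \<le> 2"
      using that by (rule part_b)
  next
    assume "c > Re (a + b) + 1"
    then have "Re s > 1" using Re_s by linarith
    then show "f3 \<in> class_UKH"
      if "Re (cmod \<alpha> * G * ((2 * a * b + c - a - b - 1) / (s - 1))) \<le> 2"
      using that by (rule part_c)
  qed
qed

end
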